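(* Let $\{P_\gamma\}_{\gamma\in I}$ be a net in $\mathcal M$ and $P\in\mathcal M$. Then $P_\gamma$ converges to $P$ vaguely if and only if $\lim_{\gamma\in I}\int_{\mathbb R}f\,dP_\gamma=\int_{\mathbb R}f\,dP$ in operator norm for every $f\in C_c(\mathbb R)$.
   Context: $\mathcal H=L^2([0,1])$. For a bounded measurable symmetric $W:[0,1]^2\to[0,1]$ (a graphon; the set of these is $\mathcal W_0$), $K_W f(x)=\int_0^1W(x,y)f(y)\,dy$ is compact self-adjoint on $\mathcal H$. For $\lambda\in\mathbb R$, $P_W(\{\lambda\})$ is the orthogonal projection onto $\ker(K_W-\lambda I)$, and for Borel $A\subseteq\mathbb R$, $P_W(A)=\sum_{\lambda\in\sigma(K_W)\cap A}P_W(\{\lambda\})$ (strong operator topology sum). $\mathcal M=\{P_W:W\in\mathcal W_0\}$. For a bounded Borel $f$ and $P=P_W$, $\int f\,dP=\sum_{\lambda\in\sigma(K_W)}f(\lambda)P_W(\{\lambda\})$ (equivalently, the operator-norm limit of the integrals of simple functions converging uniformly to $f$). A net $P_\gamma$ in $\mathcal M$ converges vaguely to $P\in\mathcal M$ if there is a dense set $D\subseteq\mathbb R$ such that $\lim_\gamma P_\gamma((a,b])=P((a,b])$ in operator norm for all $a,b\in D$. *)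

theory Defs
  imports "HOL-Analysis.Analysis"
begin

text \<open>The real Hilbert space H = L^2([0,1]) is modelled by representatives
  f :: real => real; only their values on [0,1] matter, up to Lebesgue-null sets.
  Operators are maps on representatives.\<close>

definition L2 :: "(real \<Rightarrow> real) set" where
  "L2 = {f. f \<in> borel_measurable lborel \<and> set_integrable lborel {0..1} (\<lambda>x. (f x)^2)}"

definition l2inner :: "(real \<Rightarrow> real) \<Rightarrow> (real \<Rightarrow> real) \<Rightarrow> real" where
  "l2inner f g = (LINT x:{0..1}|lborel. f x * g x)"

definition l2norm :: "(real \<Rightarrow> real) \<Rightarrow> real" where
  "l2norm f = sqrt (LINT x:{0..1}|lborel. (f x)^2)"

definition ae_eq :: "(real \<Rightarrow> real) \<Rightarrow> (real \<Rightarrow> real) \<Rightarrow> bool" where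
  "ae_eq f g \<longleftrightarrow> (AE x in lborel. x \<in> {0..1} \<longrightarrow> f x = g x)"

definition opnorm :: "((real \<Rightarrow> real) \<Rightarrow> (real \<Rightarrow> real)) \<Rightarrow> real" where
  "opnorm T = (SUP f\<in>{f\<in>L2. l2norm f \<le> 1}. l2norm (T f))"

definition graphon :: "(real \<Rightarrow> real \<Rightarrow> real) \<Rightarrow> bool" where
  "graphon W \<longleftrightarrow> (\<lambda>p. W (fst p) (snd p)) \<in> borel_measurable (lborel \<Otimes>\<^sub>M lborel)
     \<and> (\<forall>x\<in>{0..1}. \<forall>y\<in>{0..1}. 0 \<le> W x y \<and> W x y \<le> 1 \<and> W x y = W y x)"

definition K_op :: "(real \<Rightarrow> real \<Rightarrow> real) \<Rightarrow> (real \<Rightarrow> real) \<Rightarrow> (real \<Rightarrow> real)" where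
  "K_op W f = (\<lambda>x. LINT y:{0..1}|lborel. W x y * f y)"

definition K_spectrum :: "(real \<Rightarrow> real \<Rightarrow> real) \<Rightarrow> real set" where
  "K_spectrum W = {l. \<not> ((\<forall>g\<in>L2. \<exists>f\<in>L2. ae_eq (\<lambda>x. K_op W f x - l * f x) g)
       \<and> (\<forall>f\<in>L2. ae_eq (\<lambda>x. K_op W f x - l * f x) (\<lambda>x. 0) \<longrightarrow> ae_eq f (\<lambda>x. 0)))}"

definition eigenspace :: "(real \<Rightarrow> real \<Rightarrow> real) \<Rightarrow> real \<Rightarrow> (real \<Rightarrow> real) set" where
  "eigenspace W l = {f\<in>L2. ae_eq (K_op W f) (\<lambda>x. l * f x)}"

definition orth_proj :: "(real \<Rightarrow> real) set \<Rightarrow> (real \<Rightarrow> real) \<Rightarrow> (real \<Rightarrow> real)" where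
  "orth_proj E f = (SOME g. g \<in> E \<and> (\<forall>h\<in>E. l2inner (\<lambda>x. f x - g x) h = 0))"

definition P_point :: "(real \<Rightarrow> real \<Rightarrow> real) \<Rightarrow> real \<Rightarrow> (real \<Rightarrow> real) \<Rightarrow> (real \<Rightarrow> real)" where
  "P_point W l = orth_proj (eigenspace W l)"

definition l2_has_sum :: "('a \<Rightarrow> real \<Rightarrow> real) \<Rightarrow> 'a set \<Rightarrow> (real \<Rightarrow> real) \<Rightarrow> bool" where
  "l2_has_sum u S g \<longleftrightarrow> (\<forall>e>0. \<exists>F0. finite F0 \<and> F0 \<subseteq> S \<and>
      (\<forall>F. finite F \<and> F0 \<subseteq> F \<and> F \<subseteq> S \<longrightarrow> l2norm (\<lambda>x. g x - (\<Sum>a\<in>F. u a x)) < e))"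

text \<open>P_W(A) = sum over lambda in sigma(K_W) \<inter> A of P_W({lambda}) (strong operator topology)\<close>
definition P_set :: "(real \<Rightarrow> real \<Rightarrow> real) \<Rightarrow> real set \<Rightarrow> (real \<Rightarrow> real) \<Rightarrow> (real \<Rightarrow> real)" where
  "P_set W A f = (SOME g. g \<in> L2 \<and> l2_has_sum (\<lambda>l. P_point W l f) (K_spectrum W \<inter> A) g)"

definition spec_integral :: "(real \<Rightarrow> real) \<Rightarrow> (real \<Rightarrow> real \<Rightarrow> real) \<Rightarrow> (real \<Rightarrow> real) \<Rightarrow> (real \<Rightarrow> real)" where
  "spec_integral f W h = (SOME g. g \<in> L2 \<and>
      l2_has_sum (\<lambda>l x. f l * P_point W l h x) (K_spectrum W) g)"

definition directed :: "('i \<Rightarrow> 'i \<Rightarrow> bool) \<Rightarrow> bool" where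
  "directed le \<longleftrightarrow> (\<forall>i. le i i) \<and> (\<forall>i j k. le i j \<longrightarrow> le j k \<longrightarrow> le i k)
      \<and> (\<forall>i j. \<exists>k. le i k \<and> le j k)"

definition net_opnorm_tendsto ::
  "('i \<Rightarrow> 'i \<Rightarrow> bool) \<Rightarrow> ('i \<Rightarrow> (real \<Rightarrow> real) \<Rightarrow> (real \<Rightarrow> real))
     \<Rightarrow> ((real \<Rightarrow> real) \<Rightarrow> (real \<Rightarrow> real)) \<Rightarrow> bool" where
  "net_opnorm_tendsto le T S \<longleftrightarrow>
     (\<forall>e>0. \<exists>i0. \<forall>i. le i0 i \<longrightarrow> opnorm (\<lambda>h x. T i h x - S h x) < e)"

definition vague_conv ::
  "('i \<Rightarrow> 'i \<Rightarrow> bool) \<Rightarrow> ('i \<Rightarrow> real \<Rightarrow> real \<Rightarrow> real) \<Rightarrow> (real \<Rightarrow> real \<Rightarrow> real) \<Rightarrow> bool" where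
  "vague_conv le Ws W0 \<longleftrightarrow> (\<exists>D::real set. closure D = UNIV \<and>
     (\<forall>a\<in>D. \<forall>b\<in>D. net_opnorm_tendsto le (\<lambda>i. P_set (Ws i) {a<..b}) (P_set W0 {a<..b})))"

definition Cc :: "(real \<Rightarrow> real) set" where
  "Cc = {f. continuous_on UNIV f \<and> compact (closure {x. f x \<noteq> 0})}"

end

theory Submission
  imports Defs
begin

text \<open>Functional calculus is bounded by the supremum norm. Hence, if the projections of all
  intervals with endpoints in a dense set converge, so do the integrals of the corresponding step
  functions and of their uniform limits, which include \<open>C\<^sub>c\<close>. Conversely,
  Hilbert--Schmidt kernels have only finitely many eigenvalues away from 0, so the points having a
  neighbourhood free of eigenvalues of the limit are dense. At such a point a bump function has
  vanishing limit integral; once its integral along the net has norm below 1/2, the net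
  has no eigenvalue near the point either, and the projection of an interval with two such
  endpoints coincides with the integral of a continuous trapezoid.\<close>

subsection \<open>The Hilbert space of square-integrable functions\<close>

text \<open>The definitions act on representatives and choose with \<open>SOME\<close>, so
  \<open>P_set\<close> and \<open>spec_integral\<close> are determined only up to null sets.
  Everything is therefore carried to the quotient \<open>l2\<close>, a genuine Hilbert space, where
  both become \<open>spec\<close>, applied to an indicator or to the given function; operator norms
  return only at the end. An interval projection is the integral of a discontinuous function, so it
  may jump when an eigenvalue of the net crosses an endpoint; this is why endpoints must sit in gaps
  of the limit spectrum. As eigenvalues of the limit may accumulate at 0, a gap close to a given
  point is sought after a small move away from 0. The threshold 1/2 comes from a tent of height 1
  over a gap: on the inner half of the gap the tent exceeds 1/2, and an eigenvector with eigenvalue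
  there would be scaled by that value.\<close>

abbreviation unit_lborel :: "real measure" where
  "unit_lborel \<equiv> restrict_space lborel {0..1}"

lemma unit_lborel_prob: "emeasure unit_lborel (space unit_lborel) = 1"
  by (simp add: emeasure_restrict_space space_restrict_space)

interpretation unit_lborel: finite_measure unit_lborel
  by (rule finite_measureI) (use unit_lborel_prob in simp)

lemma borel_measurable_unit_lborel:
  fixes f :: "real \<Rightarrow> real"
  shows "f \<in> borel_measurable lborel \<Longrightarrow> f \<in> borel_measurable unit_lborel"
  by (rule measurable_restrict_space1)

lemma set_lebesgue_integral_unit:
  fixes f :: "real \<Rightarrow> real"
  shows "(LINT x:{0..1}|lborel. f x) = integral\<^sup>L unit_lborel f"
  by (subst integral_restrict_space) (auto simp: set_lebesgue_integral_def)

lemma L2_iff: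
  "f \<in> L2 \<longleftrightarrow> f \<in> borel_measurable lborel \<and> integrable unit_lborel (\<lambda>x. (f x)\<^sup>2)"
  by (subst integrable_restrict_space) (auto simp: L2_def set_integrable_def)

lemma l2inner_unit: "l2inner f g = (\<integral>x. f x * g x \<partial>unit_lborel)"
  unfolding l2inner_def by (rule set_lebesgue_integral_unit)

lemma l2norm_eq_sqrt_inner: "l2norm f = sqrt (l2inner f f)"
  by (simp add: l2norm_def l2inner_def power2_eq_square)

lemma ae_eq_unit: "ae_eq f g \<longleftrightarrow> (AE x in unit_lborel. f x = g x)"
  unfolding ae_eq_def by (subst AE_restrict_space_iff) auto

lemma L2_measurable: "f \<in> L2 \<Longrightarrow> f \<in> borel_measurable lborel"
  by (simp add: L2_def)

lemma L2_measurable_unit: "f \<in> L2 \<Longrightarrow> f \<in> borel_measurable unit_lborel"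
  by (rule borel_measurable_unit_lborel[OF L2_measurable])

lemma L2_integrable_mult:
  assumes "f \<in> L2" "g \<in> L2"
  shows "integrable unit_lborel (\<lambda>x. f x * g x)"
proof (rule Bochner_Integration.integrable_bound)
  show "integrable unit_lborel (\<lambda>x. (f x)\<^sup>2 + (g x)\<^sup>2)"
    using assms by (auto simp: L2_iff)
  show "(\<lambda>x. f x * g x) \<in> borel_measurable unit_lborel"
    using assms[THEN L2_measurable_unit] by simp
  have "\<bar>a * b\<bar> \<le> a\<^sup>2 + b\<^sup>2" for a b :: real
    using zero_le_power2[of "\<bar>a\<bar> - \<bar>b\<bar>"] zero_le_power2[of a] zero_le_power2[of b]
    unfolding power2_diff power2_abs abs_mult by linarith
  then show "AE x in unit_lborel. norm (f x * g x) \<le> norm ((f x)\<^sup>2 + (g x)\<^sup>2)"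
    by (auto intro: order_trans)
qed

lemma L2_bounded:
  assumes "f \<in> borel_measurable lborel" "\<And>x. x \<in> {0..1} \<Longrightarrow> \<bar>f x\<bar> \<le> C"
  shows "f \<in> L2"
  unfolding L2_iff
proof
  show "integrable unit_lborel (\<lambda>x. (f x)\<^sup>2)"
  proof (rule unit_lborel.integrable_const_bound)
    show "AE x in unit_lborel. norm ((f x)\<^sup>2) \<le> C\<^sup>2"
      using power_mono[OF assms(2), of _ 2]
      by (intro AE_I2) (auto simp: space_restrict_space)
  qed (use borel_measurable_unit_lborel[OF assms(1)] in simp)
qed fact

lemma L2_zero [simp]: "(\<lambda>x. 0) \<in> L2"
  by (simp add: L2_iff)

lemma L2_one [simp]: "(\<lambda>x. 1) \<in> L2"
  by (rule L2_bounded[where C=1]) auto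

lemma L2_scale: "f \<in> L2 \<Longrightarrow> (\<lambda>x. c * f x) \<in> L2"
  by (auto simp: L2_iff power_mult_distrib)

lemma L2_add:
  assumes "f \<in> L2" "g \<in> L2"
  shows "(\<lambda>x. f x + g x) \<in> L2"
  using assms L2_integrable_mult[OF assms]
  by (auto simp: L2_iff power2_sum mult.assoc)

lemma L2_diff:
  assumes "f \<in> L2" "g \<in> L2"
  shows "(\<lambda>x. f x - g x) \<in> L2"
  using L2_add[OF assms(1) L2_scale[OF assms(2), of "-1"]] by simp

lemma L2_abs: "f \<in> L2 \<Longrightarrow> (\<lambda>x. \<bar>f x\<bar>) \<in> L2"
  by (auto simp: L2_iff)

lemma L2_sum:
  assumes "\<And>a. a \<in> F \<Longrightarrow> u a \<in> L2"
  shows "(\<lambda>x. \<Sum>a\<in>F. u a x) \<in> L2"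
  using assms by (induction F rule: infinite_finite_induct) (auto intro: L2_add)

section \<open>The quotient of \<open>L2\<close> by almost-everywhere equality, as an inner product
  space\<close>

definition L2_rel :: "(real \<Rightarrow> real) \<Rightarrow> (real \<Rightarrow> real) \<Rightarrow> bool" where
  "L2_rel f g \<longleftrightarrow> f \<in> L2 \<and> g \<in> L2 \<and> ae_eq f g"

\<comment> \<open>The relation is reflexive only on \<open>L2\<close>, whence a partial quotient;
  the rules that compute with \<open>cls\<close> therefore assume membership in
  \<open>L2\<close>.\<close>
quotient_type l2 = "real \<Rightarrow> real" / partial: L2_rel
proof (rule part_equivpI)
  show "\<exists>f. L2_rel f f"
    by (intro exI[of _ "\<lambda>x. 0"]) (auto simp: L2_rel_def ae_eq_unit)
  show "symp L2_rel"
    by (auto simp: symp_def L2_rel_def ae_eq_unit elim: eventually_mono)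
  show "transp L2_rel"
    unfolding transp_def L2_rel_def ae_eq_unit by (auto elim: eventually_elim2)
qed

lemma L2_rel_integral_cong:
  assumes "L2_rel f f'" "L2_rel g g'"
  shows "(\<integral>x. f x * g x \<partial>unit_lborel) = (\<integral>x. f' x * g' x \<partial>unit_lborel)"
proof (rule integral_cong_AE)
  show "AE x in unit_lborel. f x * g x = f' x * g' x"
    using assms unfolding L2_rel_def ae_eq_unit by (auto elim: eventually_elim2)
qed (use assms in \<open>auto simp: L2_rel_def intro!: borel_measurable_times intro: L2_measurable_unit\<close>)

instantiation l2 :: real_inner
begin

lift_definition zero_l2 :: l2 is "\<lambda>x. 0"
  by (auto simp: L2_rel_def ae_eq_unit)

lift_definition plus_l2 :: "l2 \<Rightarrow> l2 \<Rightarrow> l2" is "\<lambda>f g x. f x + g x"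
  unfolding L2_rel_def ae_eq_unit by (auto intro: L2_add elim: eventually_elim2)

lift_definition minus_l2 :: "l2 \<Rightarrow> l2 \<Rightarrow> l2" is "\<lambda>f g x. f x - g x"
  unfolding L2_rel_def ae_eq_unit by (auto intro: L2_diff elim: eventually_elim2)

lift_definition uminus_l2 :: "l2 \<Rightarrow> l2" is "\<lambda>f x. - 1 * f x"
  unfolding L2_rel_def ae_eq_unit using L2_scale[of _ "-1"] by (auto elim: eventually_mono)

lift_definition scaleR_l2 :: "real \<Rightarrow> l2 \<Rightarrow> l2" is "\<lambda>c f x. c * f x"
  unfolding L2_rel_def ae_eq_unit by (auto intro: L2_scale elim: eventually_mono)

lift_definition inner_l2 :: "l2 \<Rightarrow> l2 \<Rightarrow> real" is "\<lambda>f g. \<integral>x. f x * g x \<partial>unit_lborel"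
  by (rule L2_rel_integral_cong)

definition norm_l2 :: "l2 \<Rightarrow> real" where "norm_l2 f = sqrt (f \<bullet> f)"
definition dist_l2 :: "l2 \<Rightarrow> l2 \<Rightarrow> real" where "dist_l2 f g = norm (f - g)"
definition sgn_l2 :: "l2 \<Rightarrow> l2" where "sgn_l2 f = inverse (norm f) *\<^sub>R f"
definition uniformity_l2 :: "(l2 \<times> l2) filter" where
  "uniformity_l2 = (INF e\<in>{0<..}. principal {(x, y). dist x y < e})"
definition open_l2 :: "l2 set \<Rightarrow> bool" where
  "open_l2 U = (\<forall>x\<in>U. eventually (\<lambda>(x', y). x' = x \<longrightarrow> y \<in> U) uniformity)"

instance
proof
  show "x + y + z = x + (y + z)" for x y z :: l2
    by transfer (auto simp: L2_rel_def ae_eq_unit algebra_simps intro!: L2_add)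
  show "x + y = y + x" for x y :: l2
    by transfer (auto simp: L2_rel_def ae_eq_unit algebra_simps intro!: L2_add)
  show "0 + x = x" for x :: l2
    by transfer (auto simp: L2_rel_def ae_eq_unit)
  show "- x + x = 0" for x :: l2
    by transfer (auto simp: L2_rel_def ae_eq_unit)
  show "x - y = x + - y" for x y :: l2
    by transfer (auto simp: L2_rel_def ae_eq_unit intro!: L2_diff)
  show "a *\<^sub>R (x + y) = a *\<^sub>R x + a *\<^sub>R y" for a and x y :: l2
    by transfer (auto simp: L2_rel_def ae_eq_unit algebra_simps intro!: L2_add L2_scale)
  show "(a + b) *\<^sub>R x = a *\<^sub>R x + b *\<^sub>R x" for a b and x :: l2
    by transfer (auto simp: L2_rel_def ae_eq_unit distrib_right intro!: L2_add L2_scale)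
  show "a *\<^sub>R b *\<^sub>R x = (a * b) *\<^sub>R x" for a b and x :: l2
    using L2_scale[of _ "a * b"]
    by transfer (auto simp: L2_rel_def ae_eq_unit mult.assoc)
  show "1 *\<^sub>R x = x" for x :: l2
    by transfer (auto simp: L2_rel_def ae_eq_unit)
  show "x \<bullet> y = y \<bullet> x" for x y :: l2
    by transfer (simp add: mult.commute)
  show "(x + y) \<bullet> z = x \<bullet> z + y \<bullet> z" for x y z :: l2
    by transfer (auto simp: L2_rel_def distrib_right L2_integrable_mult)
  show "a *\<^sub>R x \<bullet> y = a * (x \<bullet> y)" for a and x y :: l2
    by transfer (auto simp: mult.assoc)
  show "0 \<le> x \<bullet> x" for x :: l2
    by transfer simp
  show "(x \<bullet> x = 0) = (x = 0)" for x :: l2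
  proof (transfer)
    fix f assume "L2_rel f f"
    then have f: "f \<in> L2" by (simp add: L2_rel_def)
    show "((\<integral>x. f x * f x \<partial>unit_lborel) = 0) = L2_rel f (\<lambda>x. 0)"
      using integral_nonneg_eq_0_iff_AE[OF L2_integrable_mult[OF f f]] f
      by (simp add: L2_rel_def ae_eq_unit)
  qed
qed (simp_all add: norm_l2_def dist_l2_def sgn_l2_def uniformity_l2_def open_l2_def)

end

lemma L2_rel_refl [simp]: "L2_rel f f \<longleftrightarrow> f \<in> L2"
  by (simp add: L2_rel_def ae_eq_unit)

abbreviation cls :: "(real \<Rightarrow> real) \<Rightarrow> l2" where "cls \<equiv> abs_l2"

lemma cls_eq_iff: "f \<in> L2 \<Longrightarrow> g \<in> L2 \<Longrightarrow> cls f = cls g \<longleftrightarrow> ae_eq f g"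
  using Quotient3_rel[OF Quotient3_l2, of f g] by (simp add: L2_rel_def)

lemma rep_l2_L2 [simp]: "rep_l2 x \<in> L2"
  using Quotient3_rep_reflp[OF Quotient3_l2, of x] by simp

lemma cls_rep [simp]: "cls (rep_l2 x) = x"
  by (rule Quotient3_abs_rep[OF Quotient3_l2])

lemma cls_add: "f \<in> L2 \<Longrightarrow> g \<in> L2 \<Longrightarrow> cls (\<lambda>x. f x + g x) = cls f + cls g"
  by (simp add: plus_l2.abs_eq)

lemma cls_diff: "f \<in> L2 \<Longrightarrow> g \<in> L2 \<Longrightarrow> cls (\<lambda>x. f x - g x) = cls f - cls g"
  by (simp add: minus_l2.abs_eq)

lemma cls_scale: "f \<in> L2 \<Longrightarrow> cls (\<lambda>x. c * f x) = c *\<^sub>R cls f"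
  by (simp add: scaleR_l2.abs_eq)

lemma cls_zero: "cls (\<lambda>x. 0) = 0"
  by (simp add: zero_l2_def)

lemma inner_cls: "f \<in> L2 \<Longrightarrow> g \<in> L2 \<Longrightarrow> cls f \<bullet> cls g = l2inner f g"
  by (simp add: inner_l2.abs_eq l2inner_unit)

lemma norm_cls: "f \<in> L2 \<Longrightarrow> norm (cls f) = l2norm f"
  by (simp add: norm_eq_sqrt_inner inner_cls l2norm_eq_sqrt_inner)

lemma cls_sum:
  assumes "\<And>a. a \<in> F \<Longrightarrow> u a \<in> L2"
  shows "cls (\<lambda>x. \<Sum>a\<in>F. u a x) = (\<Sum>a\<in>F. cls (u a))"
  using assms
  by (induction F rule: infinite_finite_induct) (auto simp: cls_zero cls_add L2_sum)

section \<open>Completeness of \<open>l2\<close> (Riesz-Fischer)\<close>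

lemma L2_abs_integral_le:
  assumes "f \<in> L2"
  shows "integrable unit_lborel f" "(\<integral>x. \<bar>f x\<bar> \<partial>unit_lborel) \<le> l2norm f"
proof -
  show "integrable unit_lborel f"
    using L2_integrable_mult[OF assms L2_one] by simp
  \<comment> \<open>The constant function 1 has norm 1 because [0,1] has unit measure, so
    Cauchy-Schwarz against it bounds the L1 norm by the L2 norm.\<close>
  have "cls (\<lambda>x. \<bar>f x\<bar>) \<bullet> cls (\<lambda>x. 1) \<le> norm (cls (\<lambda>x. \<bar>f x\<bar>)) * norm (cls (\<lambda>x. 1))"
    by (rule norm_cauchy_schwarz)
  moreover have "l2norm (\<lambda>x. 1) = 1" "l2norm (\<lambda>x. \<bar>f x\<bar>) = l2norm f"
    using unit_lborel_prob
    by (simp_all add: l2norm_def set_lebesgue_integral_unit measure_def)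
  ultimately show "(\<integral>x. \<bar>f x\<bar> \<partial>unit_lborel) \<le> l2norm f"
    using assms by (simp add: inner_cls norm_cls L2_abs l2inner_unit)
qed

lemma l2norm_nonneg: "f \<in> L2 \<Longrightarrow> 0 \<le> l2norm f"
  by (simp flip: norm_cls)

lemma nn_integral_square_eq_l2norm:
  assumes "f \<in> L2"
  shows "(\<integral>\<^sup>+x. ennreal ((f x)\<^sup>2) \<partial>unit_lborel) = ennreal ((l2norm f)\<^sup>2)"
  using assms
  by (subst nn_integral_eq_integral) (auto simp: L2_iff l2norm_def set_lebesgue_integral_unit)

text \<open>Phrased with the nonnegative integral because Fatou's lemma delivers such a bound before
  integrability is known.\<close>

lemma l2norm_le_of_nn_integral:
  assumes f: "f \<in> borel_measurable lborel" and "0 \<le> c"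
    and le: "(\<integral>\<^sup>+x. ennreal ((f x)\<^sup>2) \<partial>unit_lborel) \<le> ennreal (c\<^sup>2)"
  shows "f \<in> L2" "l2norm f \<le> c"
proof -
  have "integrable unit_lborel (\<lambda>x. (f x)\<^sup>2)"
  proof (rule integrableI_bounded)
    show "(\<lambda>x. (f x)\<^sup>2) \<in> borel_measurable unit_lborel"
      using borel_measurable_unit_lborel[OF f] by simp
    show "(\<integral>\<^sup>+ x. ennreal (norm ((f x)\<^sup>2)) \<partial>unit_lborel) < \<infinity>"
      using le by (simp add: order_le_less_trans[OF _ ennreal_less_top])
  qed
  then show L2: "f \<in> L2"
    using f by (simp add: L2_iff)
  have "(l2norm f)\<^sup>2 \<le> c\<^sup>2"
    using le nn_integral_square_eq_l2norm[OF L2] by (simp add: ennreal_le_iff)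
  then show "l2norm f \<le> c"
    using \<open>0 \<le> c\<close> by (rule power2_le_imp_le)
qed

text \<open>The L1 norms of the increments are dominated by their L2 norms and form a convergent
  series, so the increments are absolutely summable almost everywhere. Fatou's lemma then upgrades
  the pointwise limit to an L2 limit.\<close>

lemma L2_fast_Cauchy_converges:
  assumes L2: "\<And>n. f n \<in> L2"
    and fast: "\<And>n. l2norm (\<lambda>x. f (Suc n) x - f n x) \<le> (1/2) ^ n"
  shows "\<exists>g\<in>L2. (\<lambda>n. l2norm (\<lambda>x. f n x - g x)) \<longlonglongrightarrow> 0"
proof -
  have [measurable]: "f n \<in> borel_measurable borel" for n
    using L2_measurable[OF L2, of n] by simp
  define d where "d n x = f (Suc n) x - f n x" for n x
  have d: "d n \<in> L2" for n
    unfolding d_def by (intro L2_diff L2)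
  have [measurable]: "d n \<in> borel_measurable borel" for n
    using L2_measurable[OF d, of n] by simp
  have [measurable]: "d n \<in> borel_measurable unit_lborel" for n
    using L2_measurable_unit[OF d, of n] by simp
  have d_norm: "(\<integral>\<^sup>+x. ennreal \<bar>d n x\<bar> \<partial>unit_lborel) \<le> ennreal ((1/2) ^ n)" for n
  proof -
    have "(\<integral>\<^sup>+x. ennreal \<bar>d n x\<bar> \<partial>unit_lborel) = ennreal (\<integral>x. \<bar>d n x\<bar> \<partial>unit_lborel)"
      by (rule nn_integral_eq_integral) (auto intro: L2_abs_integral_le(1) L2_abs d)
    also have "\<dots> \<le> ennreal ((1/2) ^ n)"
      using L2_abs_integral_le(2)[OF d, of n] fast[of n] unfolding d_def
      by (intro ennreal_leI) linarith
    finally show ?thesis .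
  qed
  have "(\<integral>\<^sup>+x. (\<Sum>n. ennreal \<bar>d n x\<bar>) \<partial>unit_lborel) = (\<Sum>n. \<integral>\<^sup>+x. ennreal \<bar>d n x\<bar> \<partial>unit_lborel)"
    by (rule nn_integral_suminf) simp
  also have "\<dots> \<le> (\<Sum>n. ennreal ((1/2) ^ n))"
    by (intro suminf_le d_norm) auto
  also have "\<dots> = ennreal (\<Sum>n. (1/2) ^ n)"
    by (intro suminf_ennreal2) (auto intro: summable_geometric)
  finally have "(\<integral>\<^sup>+x. (\<Sum>n. ennreal \<bar>d n x\<bar>) \<partial>unit_lborel) \<noteq> \<infinity>"
    by (auto simp: top_unique)
  then have "AE x in unit_lborel. (\<Sum>n. ennreal \<bar>d n x\<bar>) \<noteq> \<infinity>"
    by (intro nn_integral_PInf_AE) auto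
  then have conv: "AE x in unit_lborel. convergent (\<lambda>n. f n x)"
  proof eventually_elim
    case (elim x)
    then have "summable (\<lambda>n. \<bar>d n x\<bar>)"
      by (intro summable_suminf_not_top) auto
    then have "summable (\<lambda>n. d n x)"
      by (rule summable_rabs_cancel)
    then have "convergent (\<lambda>n. f 0 x + (\<Sum>i<n. d i x))"
      unfolding summable_iff_convergent by (intro convergent_add convergent_const)
    moreover have "f 0 x + (\<Sum>i<n. d i x) = f n x" for n
      unfolding d_def by (subst sum_lessThan_telescope) simp
    ultimately show ?case by simp
  qed
  \<comment> \<open>Where the sequence diverges, \<open>lim\<close> is a fixed unspecified real, so
    \<open>g\<close> is measurable everywhere and is the pointwise limit off a null set.\<close>
  define g where "g x = lim (\<lambda>n. f n x)" for x
  have g_meas [measurable]: "g \<in> borel_measurable borel"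
    unfolding g_def by measurable
  \<comment> \<open>The bound is the exact geometric sum of the steps from \<open>n\<close> to
    \<open>n + k\<close>; keeping the subtracted term makes the induction close.\<close>
  have far: "l2norm (\<lambda>x. f n x - f (n + k) x) \<le> 2 * (1/2) ^ n - 2 * (1/2) ^ (n + k)" for n k
  proof (induction k)
    case 0
    then show ?case by (simp add: l2norm_def)
  next
    case (Suc k)
    have "norm (cls (f n) - cls (f (n + Suc k)))
      \<le> norm (cls (f n) - cls (f (n + k))) + norm (cls (f (n + Suc k)) - cls (f (n + k)))"
      using norm_triangle_ineq4[of "cls (f n) - cls (f (n + k))" "cls (f (n + Suc k)) - cls (f (n + k))"]
      by simp
    then show ?case
      using Suc fast[of "n + k"]
      by (simp add: L2 L2_diff norm_cls flip: cls_diff)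
  qed
  have tail: "(\<lambda>x. f n x - g x) \<in> L2 \<and> l2norm (\<lambda>x. f n x - g x) \<le> 2 * (1/2) ^ n" for n
  proof -
    have [measurable]: "f n \<in> borel_measurable unit_lborel" for n
      using L2_measurable_unit[OF L2, of n] by simp
    \<comment> \<open>Off a null set \<open>f m\<close> tends to \<open>g\<close>, so the squared
      distance is a liminf, the form that Fatou's lemma bounds.\<close>
    have "(\<integral>\<^sup>+x. ennreal ((f n x - g x)\<^sup>2) \<partial>unit_lborel)
        = (\<integral>\<^sup>+x. liminf (\<lambda>m. ennreal ((f n x - f m x)\<^sup>2)) \<partial>unit_lborel)"
    proof (rule nn_integral_cong_AE)
      show "AE x in unit_lborel. ennreal ((f n x - g x)\<^sup>2) = liminf (\<lambda>m. ennreal ((f n x - f m x)\<^sup>2))"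
        using conv
      proof eventually_elim
        case (elim x)
        then have "(\<lambda>m. ennreal ((f n x - f m x)\<^sup>2)) \<longlonglongrightarrow> ennreal ((f n x - g x)\<^sup>2)"
          unfolding g_def by (intro tendsto_intros) (simp add: convergent_LIMSEQ_iff)
        then show ?case
          by (intro lim_imp_Liminf[symmetric] trivial_limit_sequentially)
      qed
    qed
    also have "\<dots> \<le> liminf (\<lambda>m. \<integral>\<^sup>+x. ennreal ((f n x - f m x)\<^sup>2) \<partial>unit_lborel)"
      by (rule nn_integral_liminf) measurable
    also have "\<dots> \<le> ennreal ((2 * (1/2) ^ n)\<^sup>2)"
    proof (rule order_trans[OF Liminf_le_Limsup Limsup_bounded])
      show "\<forall>\<^sub>F m in sequentially. (\<integral>\<^sup>+x. ennreal ((f n x - f m x)\<^sup>2) \<partial>unit_lborel) \<le> ennreal ((2 * (1/2) ^ n)\<^sup>2)"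
        using eventually_ge_at_top[of n]
      proof eventually_elim
        case (elim m)
        have "0 \<le> (1/2 :: real) ^ m"
          by simp
        moreover have "l2norm (\<lambda>x. f n x - f m x) \<le> 2 * (1/2) ^ n - 2 * (1/2) ^ m"
          using far[of n "m - n"] elim by simp
        ultimately have "l2norm (\<lambda>x. f n x - f m x) \<le> 2 * (1/2) ^ n"
          by linarith
        then show ?case
          unfolding nn_integral_square_eq_l2norm[OF L2_diff[OF L2 L2]]
          by (intro ennreal_leI power_mono l2norm_nonneg L2_diff L2)
      qed
    qed simp
    finally show ?thesis
      using l2norm_le_of_nn_integral[of "\<lambda>x. f n x - g x" "2 * (1/2) ^ n"] by simp
  qed
  have "g \<in> L2"
    using L2_diff[OF L2[of 0] tail[of 0, THEN conjunct1]] by simp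
  moreover have "(\<lambda>n. l2norm (\<lambda>x. f n x - g x)) \<longlonglongrightarrow> 0"
  proof (rule tendsto_sandwich[OF _ _ tendsto_const])
    show "(\<lambda>n. 2 * (1/2) ^ n :: real) \<longlonglongrightarrow> 0"
      by (intro tendsto_mult_right_zero LIMSEQ_power_zero) simp
  qed (use tail in \<open>auto intro!: always_eventually l2norm_nonneg\<close>)
  ultimately show ?thesis by blast
qed

lemma Cauchy_fast_subseq:
  fixes X :: "nat \<Rightarrow> 'a::metric_space"
  assumes "Cauchy X"
  obtains r :: "nat \<Rightarrow> nat" where "strict_mono r" "\<And>n. dist (X (r (Suc n))) (X (r n)) \<le> (1/2) ^ n"
proof -
  have "\<exists>N. \<forall>m\<ge>N. \<forall>k\<ge>N. dist (X m) (X k) < (1/2) ^ n" for n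
    using assms unfolding Cauchy_def by simp
  then obtain N where N: "\<And>n m k. m \<ge> N n \<Longrightarrow> k \<ge> N n \<Longrightarrow> dist (X m) (X k) < (1/2) ^ n"
    by metis
  \<comment> \<open>The summand \<open>n\<close> makes \<open>r\<close> strictly increasing, and the
    sum makes \<open>r n\<close> dominate \<open>N n\<close>.\<close>
  define r where "r n = n + (\<Sum>i\<le>n. N i)" for n
  have mono: "strict_mono r"
    by (rule strict_monoI_Suc) (simp add: r_def)
  have "N n \<le> r n" for n
    using member_le_sum[of n "{..n}" N] by (simp add: r_def)
  then have "dist (X (r (Suc n))) (X (r n)) \<le> (1/2) ^ n" for n
    using N[of n] strict_mono_mono[OF mono, THEN monoD, of n "Suc n"]
    by (meson less_imp_le le_SucI order.refl order_trans)
  then show ?thesis using that mono by blast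
qed

instance l2 :: complete_space
proof
  fix X :: "nat \<Rightarrow> l2" assume X: "Cauchy X"
  obtain r where r: "strict_mono r" "\<And>n. dist (X (r (Suc n))) (X (r n)) \<le> (1/2) ^ n"
    using Cauchy_fast_subseq[OF X] by blast
  define f where "f n = rep_l2 (X (r n))" for n
  have f: "f n \<in> L2" "cls (f n) = X (r n)" for n
    by (simp_all add: f_def)
  have "l2norm (\<lambda>x. f (Suc n) x - f n x) \<le> (1/2) ^ n" for n
    using r(2)[of n] by (simp add: f dist_norm L2_diff cls_diff flip: norm_cls)
  then obtain g where g: "g \<in> L2" "(\<lambda>n. l2norm (\<lambda>x. f n x - g x)) \<longlonglongrightarrow> 0"
    using L2_fast_Cauchy_converges f by blast
  have "(\<lambda>n. dist (X (r n)) (cls g)) \<longlonglongrightarrow> 0"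
    using g by (simp add: f dist_norm L2_diff cls_diff flip: norm_cls)
  then have "(X \<circ> r) \<longlonglongrightarrow> cls g"
    by (simp add: tendsto_dist_iff[of "X \<circ> r"])
  then show "convergent X"
    using Cauchy_converges_subseq[OF X r(1)] by (auto simp: convergent_def)
qed

subsection \<open>Spectral sums of a symmetric operator\<close>

lemma parallelogram_law:
  fixes x y :: "'a::real_inner"
  shows "(norm (x + y))\<^sup>2 + (norm (x - y))\<^sup>2 = 2 * (norm x)\<^sup>2 + 2 * (norm y)\<^sup>2"
  by (simp add: power2_norm_eq_inner inner_add_left inner_add_right inner_diff_left inner_diff_right)

text \<open>A minimising sequence for the distance to \<open>E\<close> is Cauchy by the
  parallelogram law. The residual of a nearest point is orthogonal to \<open>E\<close>, since
  otherwise moving along some \<open>k\<close> would come closer.\<close>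

lemma orthogonal_projection_exists:
  fixes E :: "'a::{real_inner,complete_space} set"
  assumes E: "subspace E" "closed E"
  shows "\<exists>p\<in>E. \<forall>h\<in>E. (x - p) \<bullet> h = 0"
proof -
  define \<delta> where "\<delta> = (INF h\<in>E. (norm (x - h))\<^sup>2)"
  have bdd: "bdd_below ((\<lambda>h. (norm (x - h))\<^sup>2) ` E)"
    by (rule bdd_belowI[of _ 0]) auto
  have E0: "0 \<in> E" using E(1) by (rule subspace_0)
  have lower: "\<delta> \<le> (norm (x - h))\<^sup>2" if "h \<in> E" for h
    unfolding \<delta>_def by (rule cINF_lower[OF bdd that])
  have "\<exists>h\<in>E. (norm (x - h))\<^sup>2 < \<delta> + 1 / Suc n" for n
    using cINF_less_iff[OF _ bdd, of "\<delta> + 1 / Suc n"] E0 unfolding \<delta>_def by force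
  then obtain h where h: "\<And>n. h n \<in> E" "\<And>n. (norm (x - h n))\<^sup>2 < \<delta> + 1 / Suc n"
    by metis
  \<comment> \<open>The parallelogram identity gives at most
    \<open>2 * (\<delta> + 1 / Suc m) + 2 * (\<delta> + 1 / Suc n)\<close> minus four times the
    squared distance to the midpoint. That midpoint lies in \<open>E\<close>, so the terms in
    \<open>\<delta>\<close> cancel.\<close>
  have close: "(norm (h m - h n))\<^sup>2 \<le> 2 / Suc m + 2 / Suc n" for m n
  proof -
    have "(1/2) *\<^sub>R (h m + h n) \<in> E"
      using E(1) h(1) by (intro subspace_scale subspace_add)
    then have "\<delta> \<le> (norm (x - (1/2) *\<^sub>R (h m + h n)))\<^sup>2" by (rule lower)
    moreover have "(x - h m) + (x - h n) = 2 *\<^sub>R (x - (1/2) *\<^sub>R (h m + h n))"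
      by (simp add: scaleR_diff_right scaleR_2)
    ultimately have "4 * \<delta> \<le> (norm ((x - h m) + (x - h n)))\<^sup>2"
      by (simp add: power_mult_distrib)
    moreover have "norm ((x - h m) - (x - h n)) = norm (h m - h n)"
      by (simp add: norm_minus_commute)
    ultimately show ?thesis
      using parallelogram_law[of "x - h m" "x - h n"] h(2)[of m] h(2)[of n] by simp
  qed
  have "Cauchy h"
  proof (rule metric_CauchyI)
    fix e :: real assume "0 < e"
    then obtain N where N: "inverse (real (Suc N)) < e\<^sup>2 / 4"
      using reals_Archimedean[of "e\<^sup>2 / 4"] by auto
    have "dist (h m) (h n) < e" if "m \<ge> N" "n \<ge> N" for m n
    proof -
      have "1 / Suc m \<le> inverse (real (Suc N))" "1 / Suc n \<le> inverse (real (Suc N))"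
        using that by (simp_all add: field_simps)
      then have "(norm (h m - h n))\<^sup>2 < e\<^sup>2"
        using close[of m n] N by simp
      then show ?thesis
        using \<open>0 < e\<close> by (simp add: dist_norm power2_less_imp_less)
    qed
    then show "\<exists>M. \<forall>m\<ge>M. \<forall>n\<ge>M. dist (h m) (h n) < e" by blast
  qed
  then obtain p where p: "h \<longlonglongrightarrow> p"
    using Cauchy_convergent convergent_def by blast
  have pE: "p \<in> E"
    using closed_sequentially[OF E(2) h(1) p] .
  have "(norm (x - p))\<^sup>2 \<le> \<delta>"
  proof (rule LIMSEQ_le)
    show "(\<lambda>n. (norm (x - h n))\<^sup>2) \<longlonglongrightarrow> (norm (x - p))\<^sup>2"
      by (intro tendsto_intros p)
    show "(\<lambda>n. \<delta> + 1 / Suc n) \<longlonglongrightarrow> \<delta>"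
      using tendsto_add[OF tendsto_const[of \<delta>] LIMSEQ_inverse_real_of_nat]
      by (simp add: inverse_eq_divide)
  qed (use h(2) less_imp_le in blast)
  then have minimal: "(norm (x - p))\<^sup>2 \<le> (norm (x - k))\<^sup>2" if "k \<in> E" for k
    using lower[OF that] by linarith
  have "(x - p) \<bullet> k = 0" if k: "k \<in> E" for k
  proof (cases "k = 0")
    case False
    \<comment> \<open>The value of \<open>t\<close> that minimises the distance from
      \<open>x\<close> to \<open>p + t *\<^sub>R k\<close>.\<close>
    define t where "t = ((x - p) \<bullet> k) / (k \<bullet> k)"
    have "p + t *\<^sub>R k \<in> E"
      using E(1) pE k by (intro subspace_add subspace_scale)
    then have "(norm (x - p))\<^sup>2 \<le> (norm (x - p - t *\<^sub>R k))\<^sup>2"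
      using minimal by (simp add: diff_diff_eq)
    also have "\<dots> = (norm (x - p))\<^sup>2 - 2 * t * ((x - p) \<bullet> k) + t * (t * (k \<bullet> k))"
      unfolding power2_norm_eq_inner inner_diff_left[of "x - p"] inner_diff_right[of _ "x - p"]
      by (simp add: inner_commute[of k "x - p"] algebra_simps del: inner_diff_left inner_diff_right)
    also have "\<dots> = (norm (x - p))\<^sup>2 - ((x - p) \<bullet> k)\<^sup>2 / (k \<bullet> k)"
      using False by (simp add: t_def power2_eq_square)
    finally have "((x - p) \<bullet> k)\<^sup>2 / (k \<bullet> k) \<le> 0" by simp
    moreover have "k \<bullet> k > 0" using False by simp
    ultimately show ?thesis
      by (simp add: divide_le_0_iff)
  qed simp
  then show ?thesis using pE by blast
qed

text \<open>By Pythagoras the squared norm of a finite sum is the sum of the squared norms, so the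
  Cauchy property is inherited from the bounded increasing net of these numerical sums.\<close>

lemma orthogonal_summable_on:
  fixes u :: "'i \<Rightarrow> 'a::{real_inner,complete_space}"
  assumes orth: "\<And>i j. i \<in> S \<Longrightarrow> j \<in> S \<Longrightarrow> i \<noteq> j \<Longrightarrow> u i \<bullet> u j = 0"
    and bound: "\<And>F. finite F \<Longrightarrow> F \<subseteq> S \<Longrightarrow> (\<Sum>i\<in>F. (norm (u i))\<^sup>2) \<le> B"
  shows "u summable_on S"
proof -
  define Q where "Q F = (\<Sum>i\<in>F. (norm (u i))\<^sup>2)" for F
  define Fin where "Fin = {F. finite F \<and> F \<subseteq> S}"
  define s where "s = (SUP F\<in>Fin. Q F)"
  have bdd: "bdd_above (Q ` Fin)"
    unfolding Q_def Fin_def using bound by (auto intro!: bdd_aboveI[of _ B])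
  have upper: "Q F \<le> s" if "F \<in> Fin" for F
    unfolding s_def by (rule cSUP_upper[OF that bdd])
  have "cauchy_filter (filtermap (sum u) (finite_subsets_at_top S))"
    unfolding cauchy_filter_metric_filtermap
  proof (intro allI impI)
    fix e :: real assume "0 < e"
    then have "s - (e / 2)\<^sup>2 < s" by simp
    moreover have "Fin \<noteq> {}" by (auto simp: Fin_def)
    \<comment> \<open>\<open>F0\<close> comes within \<open>(e / 2)\<^sup>2\<close> of the supremum,
      so whatever is added to it has norm below \<open>e / 2\<close>; two such extensions are then
      closer than \<open>e\<close>.\<close>
    ultimately obtain F0 where F0: "F0 \<in> Fin" "s - (e / 2)\<^sup>2 < Q F0"
      unfolding s_def less_cSUP_iff[OF \<open>Fin \<noteq> {}\<close> bdd] by blast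
    have near: "dist (sum u F) (sum u F0) < e / 2" if F: "F \<in> Fin" "F0 \<subseteq> F" for F
    proof -
      have fin: "finite F" "finite (F - F0)"
        using F by (auto simp: Fin_def)
      have "(norm (sum u F - sum u F0))\<^sup>2 = (norm (sum u (F - F0)))\<^sup>2"
        by (simp add: sum_diff[OF fin(1) F(2)])
      also have "\<dots> = Q (F - F0)"
        unfolding Q_def using fin F(1) orth
        by (intro norm_sum_Pythagorean) (auto simp: pairwise_def orthogonal_def Fin_def)
      also have "\<dots> = Q F - Q F0"
        unfolding Q_def by (rule sum_diff[OF fin(1) F(2)])
      finally have "(norm (sum u F - sum u F0))\<^sup>2 < (e / 2)\<^sup>2"
        using F0(2) upper[OF F(1)] by linarith
      then show ?thesis
        unfolding dist_norm by (rule power2_less_imp_less) (use \<open>0 < e\<close> in simp)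
    qed
    have "eventually (\<lambda>F. F \<in> Fin \<and> F0 \<subseteq> F) (finite_subsets_at_top S)"
      using F0(1) unfolding eventually_finite_subsets_at_top Fin_def by auto
    moreover have "\<forall>F G. (F \<in> Fin \<and> F0 \<subseteq> F) \<and> (G \<in> Fin \<and> F0 \<subseteq> G) \<longrightarrow> dist (sum u F) (sum u G) < e"
      by (auto intro: dist_triangle_half_l[OF near near])
    ultimately show "\<exists>P. eventually P (finite_subsets_at_top S) \<and>
        (\<forall>F G. P F \<and> P G \<longrightarrow> dist (sum u F) (sum u G) < e)"
      by (intro exI[of _ "\<lambda>F. F \<in> Fin \<and> F0 \<subseteq> F"] conjI)
  qed
  moreover have "complete (UNIV :: 'a set)"
    by (meson Cauchy_convergent UNIV_I complete_def convergent_def)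
  ultimately obtain L where "(sum u \<longlongrightarrow> L) (finite_subsets_at_top S)"
    using complete_uniform[where S=UNIV] by (force simp add: filterlim_def)
  then show ?thesis
    by (auto simp: summable_on_def has_sum_def)
qed

section \<open>Eigenprojections and the functional calculus of one operator\<close>

text \<open>Spectral sums are taken over all reals: a real which is not an eigenvalue contributes
  the zero projection.\<close>

locale symmetric_operator =
  fixes T :: "'a::{real_inner,complete_space} \<Rightarrow> 'a"
  assumes symmetric: "T x \<bullet> y = x \<bullet> T y"
begin

definition eig :: "real \<Rightarrow> 'a set" where
  "eig l = {x. T x = l *\<^sub>R x}"

text \<open>Symmetry moves \<open>T\<close> off \<open>x\<close>, which exhibits the eigenspace as
  an orthogonal complement. The locale assumes symmetry only, and this form supplies both the
  subspace property and closedness.\<close>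

lemma eig_iff: "x \<in> eig l \<longleftrightarrow> (\<forall>y. x \<bullet> (T y - l *\<^sub>R y) = 0)"
proof
  show "\<forall>y. x \<bullet> (T y - l *\<^sub>R y) = 0" if "x \<in> eig l"
    using that by (auto simp: eig_def inner_diff_right simp flip: symmetric)
  assume *: "\<forall>y. x \<bullet> (T y - l *\<^sub>R y) = 0"
  have "(T x - l *\<^sub>R x) \<bullet> y = 0" for y
    using * symmetric[of x y] by (simp add: inner_diff_left inner_diff_right)
  then have "T x - l *\<^sub>R x = 0"
    using inner_eq_zero_iff by blast
  then show "x \<in> eig l" by (simp add: eig_def)
qed

lemma subspace_eig: "subspace (eig l)"
  by (auto simp: subspace_def eig_iff inner_add_left)

lemma eig_nontrivial: "eig l \<noteq> {0} \<Longrightarrow> \<exists>x\<in>eig l. x \<noteq> 0"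
  using subspace_0[OF subspace_eig, of l] by blast

lemma closed_eig: "closed (eig l)"
proof -
  have "eig l = {x. \<forall>y. x \<bullet> (T y - l *\<^sub>R y) = 0}"
    by (auto simp: eig_iff)
  then show ?thesis
    by (simp add: closed_Collect_all closed_Collect_eq continuous_intros)
qed

definition proj :: "real \<Rightarrow> 'a \<Rightarrow> 'a" where
  "proj l x = (SOME p. p \<in> eig l \<and> (\<forall>h\<in>eig l. (x - p) \<bullet> h = 0))"

lemma proj_eig: "proj l x \<in> eig l"
  and proj_orthogonal: "h \<in> eig l \<Longrightarrow> (x - proj l x) \<bullet> h = 0"
  using someI_ex[of "\<lambda>p. p \<in> eig l \<and> (\<forall>h\<in>eig l. (x - p) \<bullet> h = 0)"]
    orthogonal_projection_exists[OF subspace_eig closed_eig, of l x]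
  unfolding proj_def by blast+

text \<open>Two candidates differ by an element of \<open>eig l\<close> that is orthogonal to all of
  \<open>eig l\<close>, hence to itself.\<close>

lemma proj_unique:
  assumes "p \<in> eig l" "\<And>h. h \<in> eig l \<Longrightarrow> (x - p) \<bullet> h = 0"
  shows "proj l x = p"
proof -
  have d: "proj l x - p \<in> eig l"
    by (rule subspace_diff[OF subspace_eig proj_eig assms(1)])
  have "(proj l x - p) \<bullet> (proj l x - p) = (x - p) \<bullet> (proj l x - p) - (x - proj l x) \<bullet> (proj l x - p)"
    by (simp add: inner_diff_left)
  then show ?thesis
    using assms(2)[OF d] proj_orthogonal[OF d, of x] by simp
qed

lemma proj_trivial: "eig l = {0} \<Longrightarrow> proj l x = 0"
  using proj_eig[of l x] by simp

lemma eig_orthogonal: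
  assumes "x \<in> eig l" "y \<in> eig m" "l \<noteq> m"
  shows "x \<bullet> y = 0"
proof -
  have "l * (x \<bullet> y) = m * (x \<bullet> y)"
    using symmetric[of x y] assms(1,2) by (simp add: eig_def)
  then show ?thesis using \<open>l \<noteq> m\<close> by simp
qed

lemma proj_of_eig: "x \<in> eig l \<Longrightarrow> proj m x = (if m = l then x else 0)"
  by (rule proj_unique) (auto simp: eig_orthogonal subspace_0 subspace_eig)

lemma norm_sum_proj:
  assumes "finite F"
  shows "(norm (\<Sum>l\<in>F. f l *\<^sub>R proj l x))\<^sup>2 = (\<Sum>l\<in>F. (f l)\<^sup>2 * (norm (proj l x))\<^sup>2)"
proof -
  have "(norm (\<Sum>l\<in>F. f l *\<^sub>R proj l x))\<^sup>2 = (\<Sum>l\<in>F. (norm (f l *\<^sub>R proj l x))\<^sup>2)"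
    using assms
    by (intro norm_sum_Pythagorean)
       (auto simp: pairwise_def orthogonal_def intro!: eig_orthogonal[OF proj_eig proj_eig])
  then show ?thesis by (simp add: power_mult_distrib)
qed

text \<open>The sum \<open>s\<close> of the projections satisfies
  \<open>x \<bullet> s = s \<bullet> s\<close>, so \<open>x\<close> splits orthogonally into
  \<open>s\<close> and \<open>x - s\<close>.\<close>

lemma Bessel:
  assumes "finite F"
  shows "(\<Sum>l\<in>F. (norm (proj l x))\<^sup>2) \<le> (norm x)\<^sup>2"
proof -
  define s where "s = (\<Sum>l\<in>F. proj l x)"
  have s: "s \<bullet> s = (\<Sum>l\<in>F. (norm (proj l x))\<^sup>2)"
    using norm_sum_proj[OF assms, of "\<lambda>_. 1" x] by (simp add: s_def power2_norm_eq_inner)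
  have "x \<bullet> proj l x = (norm (proj l x))\<^sup>2" for l
    using proj_orthogonal[OF proj_eig, of x l x] by (simp add: inner_diff_left power2_norm_eq_inner)
  then have "x \<bullet> s = s \<bullet> s"
    by (simp add: s) (simp add: s_def inner_sum_right)
  then have "(x - s) \<bullet> (x - s) = x \<bullet> x - s \<bullet> s"
    by (simp add: inner_diff_left inner_diff_right inner_commute)
  then show ?thesis
    using inner_ge_zero[of "x - s"] by (simp add: s power2_norm_eq_inner)
qed

text \<open>Pythagoras and Bessel give a bound independent of \<open>F\<close>. It yields
  summability of the spectral sums and, in the limit, the supremum-norm bound on which the
  approximation argument rests.\<close>

lemma norm_sum_proj_le:
  assumes "finite F" "\<And>l. \<bar>f l\<bar> \<le> C"
  shows "norm (\<Sum>l\<in>F. f l *\<^sub>R proj l x) \<le> C * norm x"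
proof (rule power2_le_imp_le)
  have "(norm (\<Sum>l\<in>F. f l *\<^sub>R proj l x))\<^sup>2 \<le> (\<Sum>l\<in>F. C\<^sup>2 * (norm (proj l x))\<^sup>2)"
    unfolding norm_sum_proj[OF assms(1)]
    using power_mono[OF assms(2), of _ 2] by (intro sum_mono mult_right_mono) auto
  also have "\<dots> \<le> C\<^sup>2 * (norm x)\<^sup>2"
    unfolding sum_distrib_left[symmetric] by (intro mult_left_mono Bessel assms) auto
  finally show "(norm (\<Sum>l\<in>F. f l *\<^sub>R proj l x))\<^sup>2 \<le> (C * norm x)\<^sup>2"
    by (simp add: power_mult_distrib)
  \<comment> \<open>Any argument of \<open>f\<close> would do here; the value at 0 merely witnesses
    that \<open>C\<close> is nonnegative.\<close>
  show "0 \<le> C * norm x"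
    using assms(2)[of 0] by simp
qed

lemma summable_proj:
  assumes "\<And>l. \<bar>f l\<bar> \<le> C"
  shows "(\<lambda>l. f l *\<^sub>R proj l x) summable_on S"
proof (rule orthogonal_summable_on)
  show "(f l *\<^sub>R proj l x) \<bullet> (f m *\<^sub>R proj m x) = 0" if "l \<noteq> m" for l m
    using eig_orthogonal[OF proj_eig proj_eig that] by simp
  show "(\<Sum>l\<in>F. (norm (f l *\<^sub>R proj l x))\<^sup>2) \<le> (C * norm x)\<^sup>2" if "finite F" for F
    using power_mono[OF norm_sum_proj_le[where f=f, OF that assms], of x 2]
    by (simp add: norm_sum_proj that power_mult_distrib)
qed

text \<open>The integral of \<open>f\<close> against the spectral measure of \<open>T\<close>, as an
  unordered norm-convergent sum at each vector; for an indicator it is the spectral projection of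
  the set.\<close>

definition spec :: "(real \<Rightarrow> real) \<Rightarrow> 'a \<Rightarrow> 'a" where
  "spec f x = (\<Sum>\<^sub>\<infinity>l. f l *\<^sub>R proj l x)"

lemma has_sum_spec:
  assumes "bounded (range f)"
  shows "((\<lambda>l. f l *\<^sub>R proj l x) has_sum spec f x) UNIV"
  using summable_proj[of f _ x UNIV] assms unfolding spec_def
  by (auto simp: bounded_iff intro: has_sum_infsum)

lemma spec_eqI:
  "bounded (range f) \<Longrightarrow> ((\<lambda>l. f l *\<^sub>R proj l x) has_sum y) UNIV \<Longrightarrow> spec f x = y"
  using has_sum_spec has_sum_unique by blast

lemma norm_spec_le:
  assumes "\<And>l. \<bar>f l\<bar> \<le> C"
  shows "norm (spec f x) \<le> C * norm x"
proof -
  have "((\<lambda>l. f l *\<^sub>R proj l x) has_sum spec f x) UNIV"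
    using assms by (intro has_sum_spec) (auto simp: bounded_iff)
  then have "((\<lambda>F. norm (\<Sum>l\<in>F. f l *\<^sub>R proj l x)) \<longlongrightarrow> norm (spec f x)) (finite_subsets_at_top UNIV)"
    unfolding has_sum_def by (rule tendsto_norm)
  then show ?thesis
    by (rule tendsto_upperbound)
       (auto simp: eventually_finite_subsets_at_top_weakI intro: norm_sum_proj_le assms)
qed

lemma spec_zero: "spec (\<lambda>l. 0) x = 0"
  by (simp add: spec_def)

lemma spec_add:
  assumes "bounded (range f)" "bounded (range g)"
  shows "spec (\<lambda>l. f l + g l) x = spec f x + spec g x"
proof (rule spec_eqI)
  show "bounded (range (\<lambda>l. f l + g l))"
    using bounded_plus_comp[OF assms] .
  show "((\<lambda>l. (f l + g l) *\<^sub>R proj l x) has_sum spec f x + spec g x) UNIV"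
    using has_sum_add[OF has_sum_spec[OF assms(1)] has_sum_spec[OF assms(2)]]
    by (simp add: scaleR_left_distrib)
qed

lemma spec_scale:
  assumes "bounded (range f)"
  shows "spec (\<lambda>l. c * f l) x = c *\<^sub>R spec f x"
proof (rule spec_eqI)
  show "bounded (range (\<lambda>l. c * f l))"
    using bounded_scaleR_comp[OF assms, of c] by simp
  show "((\<lambda>l. (c * f l) *\<^sub>R proj l x) has_sum c *\<^sub>R spec f x) UNIV"
    using has_sum_bounded_linear[OF bounded_linear_scaleR_right[of c] has_sum_spec[OF assms]]
    by (simp add: o_def)
qed

lemma spec_diff:
  assumes "bounded (range f)" "bounded (range g)"
  shows "spec (\<lambda>l. f l - g l) x = spec f x - spec g x"
  using spec_add[OF assms(1) bounded_scaleR_comp[OF assms(2), of "-1"]] spec_scale[OF assms(2), of "-1"]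
  by simp

text \<open>The spectral measure is carried by the eigenvalues. This allows an indicator to be
  traded for a continuous function that differs from it only inside a gap.\<close>

lemma spec_cong:
  assumes "\<And>l. eig l \<noteq> {0} \<Longrightarrow> f l = g l"
  shows "spec f x = spec g x"
proof -
  have "f l *\<^sub>R proj l x = g l *\<^sub>R proj l x" for l
    using assms[of l] proj_trivial[of l x] by (cases "eig l = {0}") auto
  then show ?thesis
    unfolding spec_def by (rule infsum_cong)
qed

text \<open>Evaluating at a unit eigenvector shows that the operator norm is at least
  \<open>\<bar>f l\<bar>\<close>, which is how an eigenvalue is detected later.\<close>

lemma spec_of_eig:
  assumes "x \<in> eig l"
  shows "spec f x = f l *\<^sub>R x"
proof -
  have "spec f x = (\<Sum>\<^sub>\<infinity>m\<in>{l}. f m *\<^sub>R proj m x)"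
    unfolding spec_def by (rule infsum_cong_neutral) (auto simp: proj_of_eig[OF assms])
  then show ?thesis by (simp add: proj_of_eig[OF assms])
qed

end

subsection \<open>Nets of symmetric operators\<close>

text \<open>The tail condition inside \<open>net_opnorm_tendsto\<close>, isolated so that
  directedness can intersect tails.\<close>

definition net_eventually :: "('i \<Rightarrow> 'i \<Rightarrow> bool) \<Rightarrow> ('i \<Rightarrow> bool) \<Rightarrow> bool" where
  "net_eventually le P \<longleftrightarrow> (\<exists>i0. \<forall>i. le i0 i \<longrightarrow> P i)"

lemma net_eventually_mono:
  "net_eventually le P \<Longrightarrow> (\<And>i. P i \<Longrightarrow> Q i) \<Longrightarrow> net_eventually le Q"
  unfolding net_eventually_def by blast

lemma net_eventually_conj:
  assumes "directed le" "net_eventually le P" "net_eventually le Q"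
  shows "net_eventually le (\<lambda>i. P i \<and> Q i)"
  using assms unfolding net_eventually_def directed_def by metis

section \<open>Dense sets and compactly supported continuous functions\<close>

lemma bounded_range_indicator [simp]: "bounded (range (indicator A :: real \<Rightarrow> real))"
  by (auto simp: bounded_iff indicator_def intro!: exI[of _ 1])

lemma dense_real_between:
  fixes D :: "real set"
  assumes "closure D = UNIV" "a < b"
  shows "\<exists>d\<in>D. a < d \<and> d < b"
proof -
  have "{a<..<b} \<inter> closure D \<noteq> {}"
    using assms by (simp add: dense_le)
  then have "{a<..<b} \<inter> D \<noteq> {}"
    using open_Int_closure_eq_empty[OF open_greaterThanLessThan, of a b D] by blast
  then show ?thesis by auto
qed

lemma Cc_bounded_support:
  assumes "f \<in> Cc"
  shows "\<exists>M>0. \<forall>x. M < \<bar>x\<bar> \<longrightarrow> f x = 0"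
proof -
  have "bounded {x. f x \<noteq> 0}"
    using assms bounded_subset[OF compact_imp_bounded closure_subset] by (auto simp: Cc_def)
  then show ?thesis
    unfolding bounded_pos by fastforce
qed

lemma Cc_bounded:
  assumes "f \<in> Cc"
  shows "bounded (range f)"
proof -
  have "compact (f ` closure {x. f x \<noteq> 0})"
    using assms unfolding Cc_def
    by (blast intro: compact_continuous_image continuous_on_subset[OF _ subset_UNIV])
  moreover have "range f \<subseteq> insert 0 (f ` closure {x. f x \<noteq> 0})"
    using closure_subset[of "{x. f x \<noteq> 0}"] by auto
  ultimately show ?thesis
    by (meson bounded_insert bounded_subset compact_imp_bounded)
qed

lemma CcI:
  assumes "continuous_on UNIV f" "\<And>x. x \<notin> {a..b} \<Longrightarrow> f x = 0"
  shows "f \<in> Cc"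
proof -
  have "{x. f x \<noteq> 0} \<subseteq> {a..b}"
    using assms(2) by blast
  then have "bounded {x. f x \<noteq> 0}"
    by (rule bounded_subset[OF bounded_closed_interval])
  then show ?thesis
    using assms(1) by (simp add: Cc_def)
qed

lemma Cc_uniformly_continuous:
  assumes "f \<in> Cc" "0 < e"
  shows "\<exists>\<delta>>0. \<forall>x y. \<bar>x - y\<bar> < \<delta> \<longrightarrow> \<bar>f x - f y\<bar> < e"
proof -
  obtain M where M: "M > 0" "\<And>x. M < \<bar>x\<bar> \<Longrightarrow> f x = 0"
    using Cc_bounded_support[OF assms(1)] by blast
  \<comment> \<open>The margin 1 around the support matches \<open>min d 1\<close> below: if one of
    two points closer than 1 leaves this interval, both lie outside the support.\<close>
  have "uniformly_continuous_on {- M - 1..M + 1} f"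
    using assms(1)
    by (intro compact_uniformly_continuous) (auto simp: Cc_def intro: continuous_on_subset)
  then obtain d where d: "d > 0"
    "\<And>x y. x \<in> {- M - 1..M + 1} \<Longrightarrow> y \<in> {- M - 1..M + 1} \<Longrightarrow> dist y x < d \<Longrightarrow> dist (f y) (f x) < e"
    using assms(2) unfolding uniformly_continuous_on_def by metis
  have "\<bar>f x - f y\<bar> < e" if xy: "\<bar>x - y\<bar> < min d 1" for x y
  proof (cases "x \<in> {- M - 1..M + 1} \<and> y \<in> {- M - 1..M + 1}")
    case True
    then show ?thesis using d(2)[of y x] xy by (simp add: dist_real_def)
  next
    case False
    then have "M < \<bar>x\<bar>" "M < \<bar>y\<bar>" using xy by auto
    then show ?thesis using M(2) assms(2) by simp
  qed
  then show ?thesis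
    using d(1) by (intro exI[of _ "min d 1"]) auto
qed

section \<open>Convergence of the functional calculus along a net\<close>

locale symmetric_operator_net = lim: symmetric_operator T0
  for T0 :: "'a::{real_inner,complete_space} \<Rightarrow> 'a" +
  fixes le :: "'i \<Rightarrow> 'i \<Rightarrow> bool" and T :: "'i \<Rightarrow> 'a \<Rightarrow> 'a"
  assumes directed: "directed le"
    and symmetric_net: "symmetric_operator (T i)"
begin

sublocale net: symmetric_operator "T i" for i
  by (rule symmetric_net)

text \<open>Operator-norm convergence with the supremum unfolded over the unit ball. The bound is
  non-strict because strict bounds at each vector need not survive in the supremum.\<close>

definition spec_tendsto :: "(real \<Rightarrow> real) \<Rightarrow> bool" where
  "spec_tendsto f \<longleftrightarrow>
     (\<forall>e>0. net_eventually le (\<lambda>i. \<forall>x. norm x \<le> 1 \<longrightarrow> norm (net.spec i f x - lim.spec f x) \<le> e))"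

lemma spec_tendsto_zero: "spec_tendsto (\<lambda>l. 0)"
  by (simp add: spec_tendsto_def net_eventually_def net.spec_zero lim.spec_zero)

lemma spec_tendsto_add:
  assumes "bounded (range f)" "bounded (range g)" "spec_tendsto f" "spec_tendsto g"
  shows "spec_tendsto (\<lambda>l. f l + g l)"
  unfolding spec_tendsto_def
proof (intro allI impI)
  fix e :: real assume "0 < e"
  then have "0 < e / 2" by simp
  from net_eventually_conj[OF directed assms(3)[unfolded spec_tendsto_def, rule_format, OF this]
      assms(4)[unfolded spec_tendsto_def, rule_format, OF this]]
  show "net_eventually le (\<lambda>i. \<forall>x. norm x \<le> 1 \<longrightarrow>
      norm (net.spec i (\<lambda>l. f l + g l) x - lim.spec (\<lambda>l. f l + g l) x) \<le> e)"
  proof (rule net_eventually_mono, intro allI impI)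
    fix i and x :: 'a
    assume *: "(\<forall>x. norm x \<le> 1 \<longrightarrow> norm (net.spec i f x - lim.spec f x) \<le> e / 2)
      \<and> (\<forall>x. norm x \<le> 1 \<longrightarrow> norm (net.spec i g x - lim.spec g x) \<le> e / 2)" and "norm x \<le> 1"
    have "net.spec i (\<lambda>l. f l + g l) x - lim.spec (\<lambda>l. f l + g l) x
        = (net.spec i f x - lim.spec f x) + (net.spec i g x - lim.spec g x)"
      by (simp add: net.spec_add lim.spec_add assms)
    then show "norm (net.spec i (\<lambda>l. f l + g l) x - lim.spec (\<lambda>l. f l + g l) x) \<le> e"
      using norm_triangle_le[of "net.spec i f x - lim.spec f x" "net.spec i g x - lim.spec g x" e]
        * \<open>norm x \<le> 1\<close> by fastforce
  qed
qed

lemma spec_tendsto_scale: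
  assumes "bounded (range f)" "spec_tendsto f"
  shows "spec_tendsto (\<lambda>l. c * f l)"
  unfolding spec_tendsto_def
proof (intro allI impI)
  fix e :: real assume "0 < e"
  \<comment> \<open>Adding 1 keeps the divisor positive when \<open>c\<close> is 0.\<close>
  then have "0 < e / (\<bar>c\<bar> + 1)" by simp
  then have "net_eventually le (\<lambda>i. \<forall>x. norm x \<le> 1 \<longrightarrow> norm (net.spec i f x - lim.spec f x) \<le> e / (\<bar>c\<bar> + 1))"
    using assms(2) unfolding spec_tendsto_def by blast
  then show "net_eventually le (\<lambda>i. \<forall>x. norm x \<le> 1 \<longrightarrow>
      norm (net.spec i (\<lambda>l. c * f l) x - lim.spec (\<lambda>l. c * f l) x) \<le> e)"
  proof (rule net_eventually_mono, intro allI impI)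
    fix i and x :: 'a
    assume *: "\<forall>x. norm x \<le> 1 \<longrightarrow> norm (net.spec i f x - lim.spec f x) \<le> e / (\<bar>c\<bar> + 1)" and "norm x \<le> 1"
    have "norm (net.spec i (\<lambda>l. c * f l) x - lim.spec (\<lambda>l. c * f l) x)
        = \<bar>c\<bar> * norm (net.spec i f x - lim.spec f x)"
      by (simp add: net.spec_scale lim.spec_scale assms flip: scaleR_diff_right)
    also have "\<dots> \<le> (\<bar>c\<bar> + 1) * (e / (\<bar>c\<bar> + 1))"
      using * \<open>norm x \<le> 1\<close> by (intro mult_mono) auto
    also have "\<dots> = e" by simp
    finally show "norm (net.spec i (\<lambda>l. c * f l) x - lim.spec (\<lambda>l. c * f l) x) \<le> e" .
  qed
qed

text \<open>By \<open>norm_spec_le\<close>, replacing \<open>f\<close> by \<open>g\<close> costs at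
  most \<open>e / 3\<close> for every index at once and for the limit as well, so the three-term
  estimate is uniform along the net.\<close>

lemma spec_tendsto_uniform_limit:
  assumes f: "bounded (range f)"
    and approx: "\<And>e. 0 < e \<Longrightarrow> \<exists>g. bounded (range g) \<and> spec_tendsto g \<and> (\<forall>l. \<bar>f l - g l\<bar> \<le> e)"
  shows "spec_tendsto f"
  unfolding spec_tendsto_def
proof (intro allI impI)
  fix e :: real assume "0 < e"
  then obtain g where g: "bounded (range g)" "spec_tendsto g" "\<And>l. \<bar>f l - g l\<bar> \<le> e / 3"
    using approx[of "e / 3"] by auto
  have "net_eventually le (\<lambda>i. \<forall>x. norm x \<le> 1 \<longrightarrow> norm (net.spec i g x - lim.spec g x) \<le> e / 3)"
    using g(2)[unfolded spec_tendsto_def, rule_format, of "e / 3"] \<open>0 < e\<close> by (simp only: zero_less_divide_iff zero_less_numeral simp_thms)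
  then show "net_eventually le (\<lambda>i. \<forall>x. norm x \<le> 1 \<longrightarrow> norm (net.spec i f x - lim.spec f x) \<le> e)"
  proof (rule net_eventually_mono, intro allI impI)
    fix i and x :: 'a
    assume *: "\<forall>x. norm x \<le> 1 \<longrightarrow> norm (net.spec i g x - lim.spec g x) \<le> e / 3" and x: "norm x \<le> 1"
    have bound: "e / 3 * norm x \<le> e / 3"
      using x \<open>0 < e\<close> by (simp add: mult_left_le)
    have 1: "norm (net.spec i f x - net.spec i g x) \<le> e / 3"
      using net.norm_spec_le[of "\<lambda>l. f l - g l", OF g(3), of i x] bound
      unfolding net.spec_diff[OF f g(1)] by linarith
    have 2: "norm (lim.spec f x - lim.spec g x) \<le> e / 3"
      using lim.norm_spec_le[of "\<lambda>l. f l - g l", OF g(3), of x] bound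
      unfolding lim.spec_diff[OF f g(1)] by linarith
    have "net.spec i f x - lim.spec f x
        = (net.spec i f x - net.spec i g x) + (net.spec i g x - lim.spec g x) - (lim.spec f x - lim.spec g x)"
      by simp
    then have "norm (net.spec i f x - lim.spec f x) \<le> norm (net.spec i f x - net.spec i g x)
        + norm (net.spec i g x - lim.spec g x) + norm (lim.spec f x - lim.spec g x)"
      by (metis (no_types, opaque_lifting) norm_triangle_ineq norm_triangle_ineq4 add_right_mono order_trans)
    moreover have "norm (net.spec i g x - lim.spec g x) \<le> e / 3"
      using * x by blast
    ultimately show "norm (net.spec i f x - lim.spec f x) \<le> e"
      using 1 2 by linarith
  qed
qed

lemma spec_tendsto_Cc_of_intervals:
  assumes D: "closure D = UNIV"
    and conv: "\<And>a b. a \<in> D \<Longrightarrow> b \<in> D \<Longrightarrow> spec_tendsto (indicator {a<..b})"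
    and f: "f \<in> Cc"
  shows "spec_tendsto f"
proof (rule spec_tendsto_uniform_limit[OF Cc_bounded[OF f]])
  fix e :: real assume "0 < e"
  obtain M where M: "M > 0" "\<And>x. M < \<bar>x\<bar> \<Longrightarrow> f x = 0"
    using Cc_bounded_support[OF f] by blast
  obtain \<delta> where \<delta>: "\<delta> > 0" "\<And>x y. \<bar>x - y\<bar> < \<delta> \<Longrightarrow> \<bar>f x - f y\<bar> < e"
    using Cc_uniformly_continuous[OF f \<open>0 < e\<close>] by blast
  \<comment> \<open>Starting left of the support, the zero function approximates \<open>f\<close> on
    everything up to \<open>a\<close>, which is the base case.\<close>
  obtain a where a: "a \<in> D" "a < - M"
    using dense_real_between[OF D, of "- M - 1" "- M"] by auto
  \<comment> \<open>The step function grows from left to right. Each new endpoint lies more than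
    \<open>\<delta> / 2\<close> further, so finitely many steps pass \<open>M\<close>, and less than
    \<open>\<delta>\<close> further, so \<open>f\<close> varies by less than \<open>e\<close> on the
    new piece. Vanishing beyond \<open>b\<close> lets the next piece be added without
    overlap.\<close>
  have "\<exists>b\<in>D. a + n * (\<delta> / 2) \<le> b \<and> (\<exists>g. bounded (range g) \<and> spec_tendsto g \<and>
      (\<forall>l\<le>b. \<bar>f l - g l\<bar> \<le> e) \<and> (\<forall>l>b. g l = 0))" for n :: nat
  proof (induction n)
    case 0
    have "\<forall>l\<le>a. f l = 0" using M a by auto
    then show ?case
      using a(1) spec_tendsto_zero \<open>0 < e\<close>
      by (intro bexI[of _ a] conjI exI[of _ "\<lambda>l. 0"]) auto
  next
    case (Suc n)
    then obtain b g where b: "b \<in> D" "a + n * (\<delta> / 2) \<le> b"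
      and g: "bounded (range g)" "spec_tendsto g" "\<And>l. l \<le> b \<Longrightarrow> \<bar>f l - g l\<bar> \<le> e" "\<And>l. b < l \<Longrightarrow> g l = 0"
      by blast
    obtain c where c: "c \<in> D" "b + \<delta> / 2 < c" "c < b + \<delta>"
      using dense_real_between[OF D, of "b + \<delta> / 2" "b + \<delta>"] \<delta>(1) by auto
    define s where "s l = f c * indicator {b<..c} l" for l
    have s: "bounded (range s)" "spec_tendsto s"
      unfolding s_def using bounded_scaleR_comp[OF bounded_range_indicator, of "f c" "{b<..c}"]
      by (simp_all add: spec_tendsto_scale conv b(1) c(1))
    have "\<bar>f l - (g l + s l)\<bar> \<le> e" if "l \<le> c" for l
    proof (cases "l \<le> b")
      case True
      then show ?thesis using g(3) by (simp add: s_def)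
    next
      case False
      then have "\<bar>f l - f c\<bar> < e" using that c by (intro \<delta>(2)) auto
      then show ?thesis using False that g(4)[of l] by (simp add: s_def)
    qed
    moreover have "\<forall>l>c. g l + s l = 0"
      using g(4) c \<delta>(1) by (auto simp: s_def)
    moreover have "a + Suc n * (\<delta> / 2) \<le> c"
      using b(2) c(2) by (simp add: algebra_simps add_divide_distrib)
    ultimately show ?case
      using c(1) bounded_plus_comp[OF g(1) s(1)] spec_tendsto_add[OF g(1) s(1) g(2) s(2)]
      by (intro bexI[of _ c] conjI exI[of _ "\<lambda>l. g l + s l"]) auto
  qed
  moreover obtain n :: nat where "(M - a) / (\<delta> / 2) < n"
    using reals_Archimedean2 by blast
  ultimately obtain b g where b: "a + n * (\<delta> / 2) \<le> b"
    and g: "bounded (range g)" "spec_tendsto g" "\<And>l. l \<le> b \<Longrightarrow> \<bar>f l - g l\<bar> \<le> e" "\<And>l. b < l \<Longrightarrow> g l = 0"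
    by blast
  have "M < b"
    using b \<open>(M - a) / (\<delta> / 2) < n\<close> \<delta>(1) by (simp add: field_simps)
  then have "\<bar>f l - g l\<bar> \<le> e" for l
    using g(3)[of l] g(4)[of l] M(2)[of l] M(1) \<open>0 < e\<close> by (cases "l \<le> b") auto
  then show "\<exists>g. bounded (range g) \<and> spec_tendsto g \<and> (\<forall>l. \<bar>f l - g l\<bar> \<le> e)"
    using g(1,2) by blast
qed

text \<open>A bump function at a gap of the limit spectrum has vanishing limit integral, so
  eventually the operators of the net have no eigenvalue near the centre of the gap either.\<close>

lemma eventually_no_eigenvalue_near:
  assumes conv: "\<And>f. f \<in> Cc \<Longrightarrow> spec_tendsto f"
    and "0 < \<epsilon>" and gap: "\<And>l. \<bar>l - a\<bar> < \<epsilon> \<Longrightarrow> lim.eig l = {0}"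
  shows "net_eventually le (\<lambda>i. \<forall>l. \<bar>l - a\<bar> < \<epsilon> / 2 \<longrightarrow> net.eig i l = {0})"
proof -
  \<comment> \<open>A tent of height 1 over the gap; it exceeds 1/2 exactly within
    \<open>\<epsilon> / 2\<close> of \<open>a\<close>.\<close>
  define g where "g l = max 0 (1 - \<bar>l - a\<bar> / \<epsilon>)" for l
  have "g \<in> Cc"
  proof (rule CcI)
    show "continuous_on UNIV g"
      unfolding g_def using \<open>0 < \<epsilon>\<close> by (intro continuous_intros) auto
    show "g l = 0" if "l \<notin> {a - \<epsilon>..a + \<epsilon>}" for l
    proof -
      have "1 \<le> \<bar>l - a\<bar> / \<epsilon>"
        using that \<open>0 < \<epsilon>\<close> by (auto simp: le_divide_eq)
      then show ?thesis by (simp add: g_def)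
    qed
  qed
  have "lim.spec g x = 0" for x
  proof -
    \<comment> \<open>Inside the gap the limit has no eigenvalues, and outside it the tent is
      0.\<close>
    have "lim.spec g x = lim.spec (\<lambda>l. 0) x"
      by (rule lim.spec_cong) (use gap \<open>0 < \<epsilon>\<close> in \<open>force simp: g_def max_def not_le pos_divide_less_eq\<close>)
    then show ?thesis by (simp add: lim.spec_zero)
  qed
  then have "net_eventually le (\<lambda>i. \<forall>x. norm x \<le> 1 \<longrightarrow> norm (net.spec i g x) \<le> 1 / 2)"
    using conv[OF \<open>g \<in> Cc\<close>, unfolded spec_tendsto_def, rule_format, of "1 / 2"] by simp
  then show ?thesis
  proof (rule net_eventually_mono, intro allI impI)
    fix i l assume *: "\<forall>x. norm x \<le> 1 \<longrightarrow> norm (net.spec i g x) \<le> 1 / 2" and l: "\<bar>l - a\<bar> < \<epsilon> / 2"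
    have "1 / 2 < g l"
      using l \<open>0 < \<epsilon>\<close> by (simp add: g_def field_simps)
    show "net.eig i l = {0}"
    proof (rule ccontr)
      assume "net.eig i l \<noteq> {0}"
      then obtain x where "x \<in> net.eig i l" "x \<noteq> 0"
        using net.eig_nontrivial by blast
      \<comment> \<open>At a unit eigenvector \<open>spec\<close> acts as multiplication by
        \<open>g l\<close>, which would violate the bound 1/2.\<close>
      then have sgn: "sgn x \<in> net.eig i l" "norm (sgn x) = 1"
        by (simp_all add: sgn_div_norm subspace_scale[OF net.subspace_eig])
      then have "norm (net.spec i g (sgn x)) = \<bar>g l\<bar>"
        by (simp add: net.spec_of_eig[OF sgn(1)])
      then show False
        using *[rule_format, of "sgn x"] sgn(2) \<open>1 / 2 < g l\<close> by linarith
    qed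
  qed
qed

lemma spec_tendsto_interval_of_Cc:
  assumes conv: "\<And>f. f \<in> Cc \<Longrightarrow> spec_tendsto f"
    and "0 < \<epsilon>" and gap: "\<And>l. \<bar>l - a\<bar> < \<epsilon> \<or> \<bar>l - b\<bar> < \<epsilon> \<Longrightarrow> lim.eig l = {0}"
  shows "spec_tendsto (indicator {a<..b})"
proof -
  \<comment> \<open>A trapezoid whose ramps have width \<open>\<epsilon>\<close> and are centred at
    \<open>a\<close> and \<open>b\<close>. It differs from the indicator only within
    \<open>\<epsilon> / 2\<close> of an endpoint, the radius that
    \<open>eventually_no_eigenvalue_near\<close> clears. The minimum of the two ramps also covers
    \<open>b \<le> a\<close>.\<close>
  define f where "f l = max 0 (min 1 (min (1 / 2 + (l - a) / \<epsilon>) (1 / 2 + (b - l) / \<epsilon>)))" for l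
  have f_left: "f l = 0" if "\<epsilon> / 2 \<le> a - l" for l
  proof -
    have "(l - a) / \<epsilon> \<le> - 1 / 2"
      using that \<open>0 < \<epsilon>\<close> by (simp add: divide_le_eq)
    then show ?thesis unfolding f_def by linarith
  qed
  have f_right: "f l = 0" if "\<epsilon> / 2 \<le> l - b" for l
  proof -
    have "(b - l) / \<epsilon> \<le> - 1 / 2"
      using that \<open>0 < \<epsilon>\<close> by (simp add: divide_le_eq)
    then show ?thesis unfolding f_def by linarith
  qed
  have f_middle: "f l = 1" if "\<epsilon> / 2 \<le> l - a" "\<epsilon> / 2 \<le> b - l" for l
  proof -
    have "1 / 2 \<le> (l - a) / \<epsilon>" "1 / 2 \<le> (b - l) / \<epsilon>"
      using that \<open>0 < \<epsilon>\<close> by (simp_all add: le_divide_eq)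
    then show ?thesis unfolding f_def by linarith
  qed
  have "f \<in> Cc"
  proof (rule CcI)
    show "continuous_on UNIV f"
      unfolding f_def using \<open>0 < \<epsilon>\<close> by (intro continuous_intros) auto
    show "f l = 0" if "l \<notin> {a - \<epsilon>..b + \<epsilon>}" for l
      using that f_left[of l] f_right[of l] \<open>0 < \<epsilon>\<close> by fastforce
  qed
  have f_eq: "f l = indicator {a<..b} l" if "\<epsilon> / 2 \<le> \<bar>l - a\<bar>" "\<epsilon> / 2 \<le> \<bar>l - b\<bar>" for l
  proof -
    consider "l \<le> a" | "b < l" | "a < l" "l \<le> b" by linarith
    then show ?thesis
    proof cases
      case 1
      then show ?thesis using that(1) f_left[of l] by simp
    next
      case 2
      then show ?thesis using that(2) f_right[of l] by simp
    next
      case 3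
      then show ?thesis using that f_middle[of l] by simp
    qed
  qed
  have lim: "lim.spec (indicator {a<..b}) x = lim.spec f x" for x
  proof (rule lim.spec_cong)
    fix l assume "lim.eig l \<noteq> {0}"
    then have "\<epsilon> \<le> \<bar>l - a\<bar>" "\<epsilon> \<le> \<bar>l - b\<bar>"
      using gap[of l] by (auto simp: not_less)
    then show "indicator {a<..b} l = f l"
      using f_eq[of l] \<open>0 < \<epsilon>\<close> by simp
  qed
  have "net_eventually le (\<lambda>i. (\<forall>l. \<bar>l - a\<bar> < \<epsilon> / 2 \<longrightarrow> net.eig i l = {0})
      \<and> (\<forall>l. \<bar>l - b\<bar> < \<epsilon> / 2 \<longrightarrow> net.eig i l = {0}))"
    using gap by (intro net_eventually_conj directed eventually_no_eigenvalue_near conv \<open>0 < \<epsilon>\<close>) auto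
  \<comment> \<open>Eventually the net has no eigenvalue where trapezoid and indicator differ, so
    the two integrals agree exactly and the limit for \<open>f\<close> transfers without an error
    term.\<close>
  then have ev: "net_eventually le (\<lambda>i. \<forall>x. net.spec i (indicator {a<..b}) x = net.spec i f x)"
  proof (rule net_eventually_mono, intro allI net.spec_cong)
    fix i and l :: real
    assume "(\<forall>l. \<bar>l - a\<bar> < \<epsilon> / 2 \<longrightarrow> net.eig i l = {0}) \<and> (\<forall>l. \<bar>l - b\<bar> < \<epsilon> / 2 \<longrightarrow> net.eig i l = {0})"
      and "net.eig i l \<noteq> {0}"
    then show "indicator {a<..b} l = f l"
      using f_eq[of l] by (metis not_less)
  qed
  show ?thesis
    unfolding spec_tendsto_def
  proof (intro allI impI)
    fix e :: real assume "0 < e"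
    then have "net_eventually le (\<lambda>i. \<forall>x. norm x \<le> 1 \<longrightarrow> norm (net.spec i f x - lim.spec f x) \<le> e)"
      using conv[OF \<open>f \<in> Cc\<close>] unfolding spec_tendsto_def by blast
    from net_eventually_conj[OF directed ev this]
    show "net_eventually le (\<lambda>i. \<forall>x. norm x \<le> 1 \<longrightarrow>
        norm (net.spec i (indicator {a<..b}) x - lim.spec (indicator {a<..b}) x) \<le> e)"
      by (rule net_eventually_mono) (simp add: lim)
  qed
qed

text \<open>\<open>discrete\<close> leaves 0 as the only possible accumulation point of eigenvalues
  of the limit, which makes the set of admissible endpoints dense.\<close>

theorem spec_tendsto_intervals_iff_Cc:
  assumes discrete: "\<And>\<delta>. 0 < \<delta> \<Longrightarrow> finite {l. \<delta> \<le> \<bar>l\<bar> \<and> lim.eig l \<noteq> {0}}"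
  shows "(\<exists>D. closure D = UNIV \<and> (\<forall>a\<in>D. \<forall>b\<in>D. spec_tendsto (indicator {a<..b})))
    \<longleftrightarrow> (\<forall>f\<in>Cc. spec_tendsto f)"
proof
  assume "\<exists>D. closure D = UNIV \<and> (\<forall>a\<in>D. \<forall>b\<in>D. spec_tendsto (indicator {a<..b}))"
  then show "\<forall>f\<in>Cc. spec_tendsto f"
    using spec_tendsto_Cc_of_intervals by blast
next
  assume conv: "\<forall>f\<in>Cc. spec_tendsto f"
  \<comment> \<open>This set depends on the limit alone and serves the whole net.\<close>
  define D where "D = {a. \<exists>\<epsilon>>0. \<forall>l. \<bar>l - a\<bar> < \<epsilon> \<longrightarrow> lim.eig l = {0}}"
  have "spec_tendsto (indicator {a<..b})" if "a \<in> D" "b \<in> D" for a b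
  proof -
    obtain \<epsilon> where \<epsilon>: "0 < \<epsilon>" "\<forall>l. \<bar>l - a\<bar> < \<epsilon> \<longrightarrow> lim.eig l = {0}"
      using \<open>a \<in> D\<close> unfolding D_def mem_Collect_eq by (elim exE conjE)
    obtain \<epsilon>' where \<epsilon>': "0 < \<epsilon>'" "\<forall>l. \<bar>l - b\<bar> < \<epsilon>' \<longrightarrow> lim.eig l = {0}"
      using \<open>b \<in> D\<close> unfolding D_def mem_Collect_eq by (elim exE conjE)
    show ?thesis
    proof (rule spec_tendsto_interval_of_Cc)
      show "0 < min \<epsilon> \<epsilon>'"
        using \<epsilon>(1) \<epsilon>'(1) by simp
      show "lim.eig l = {0}" if "\<bar>l - a\<bar> < min \<epsilon> \<epsilon>' \<or> \<bar>l - b\<bar> < min \<epsilon> \<epsilon>'" for l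
        using that \<epsilon>(2)[rule_format, of l] \<epsilon>'(2)[rule_format, of l] by linarith
    qed (use conv in blast)
  qed
  moreover have "closure D = UNIV"
  proof (rule UNIV_eq_I[symmetric], unfold closure_approachable, intro allI impI)
    fix x e :: real assume "0 < e"
    \<comment> \<open>Moving by \<open>e / 2\<close> away from 0 puts the interval of radius
      \<open>e / 4\<close> around \<open>c\<close> at distance at least \<open>e / 4\<close> from 0,
      where only finitely many eigenvalues remain, and within \<open>3 * e / 4\<close> of
      \<open>x\<close>.\<close>
    define c where "c = (if 0 \<le> x then x + e / 2 else x - e / 2)"
    define \<delta> where "\<delta> = e / 4"
    define E where "E = {l. \<delta> \<le> \<bar>l\<bar> \<and> lim.eig l \<noteq> {0}}"
    have E: "finite E"
      unfolding E_def using \<open>0 < e\<close> by (intro discrete) (simp add: \<delta>_def)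
    have "infinite {c - \<delta><..<c + \<delta>}"
      using \<open>0 < e\<close> by (simp add: \<delta>_def)
    then obtain a where a: "a \<in> {c - \<delta><..<c + \<delta>}" "a \<notin> E"
      using E by (meson finite_subset subsetI)
    have "open ({c - \<delta><..<c + \<delta>} - E)"
      using finite_imp_closed[OF E] by (intro open_Diff) auto
    then obtain \<epsilon> where \<epsilon>: "0 < \<epsilon>" "\<And>l. \<bar>l - a\<bar> < \<epsilon> \<Longrightarrow> l \<in> {c - \<delta><..<c + \<delta>} - E"
      using a unfolding open_dist dist_real_def by blast
    have "lim.eig l = {0}" if "\<bar>l - a\<bar> < \<epsilon>" for l
      using \<epsilon>(2)[OF that] \<open>0 < e\<close> by (auto simp: E_def c_def \<delta>_def split: if_splits)
    then have "a \<in> D"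
      unfolding D_def using \<epsilon>(1) by blast
    moreover have "dist a x < e"
      using a(1) \<open>0 < e\<close> by (auto simp: c_def \<delta>_def dist_real_def split: if_splits)
    ultimately show "\<exists>y\<in>D. dist y x < e" by blast
  qed
  ultimately show "\<exists>D. closure D = UNIV \<and> (\<forall>a\<in>D. \<forall>b\<in>D. spec_tendsto (indicator {a<..b}))"
    by blast
qed

end

subsection \<open>Graphon operators\<close>

text \<open>The condition on finite sets in \<open>l2_has_sum\<close> is convergence along
  \<open>finite_subsets_at_top\<close>, once distances between classes are computed on
  representatives.\<close>

lemma l2_has_sum_iff:
  assumes "\<And>a. a \<in> S \<Longrightarrow> u a \<in> L2" "g \<in> L2"
  shows "l2_has_sum u S g \<longleftrightarrow> ((\<lambda>a. cls (u a)) has_sum cls g) S"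
proof -
  have "dist (\<Sum>a\<in>F. cls (u a)) (cls g) = l2norm (\<lambda>x. g x - (\<Sum>a\<in>F. u a x))" if "F \<subseteq> S" for F
  proof -
    have u: "\<And>a. a \<in> F \<Longrightarrow> u a \<in> L2" using that assms(1) by blast
    show ?thesis
      using u assms(2)
      by (simp add: dist_norm norm_minus_commute[of _ "cls g"] L2_diff L2_sum cls_diff cls_sum flip: norm_cls)
  qed
  then show ?thesis
    unfolding l2_has_sum_def has_sum_def tendsto_iff eventually_finite_subsets_at_top
    by (simp add: conj_commute cong: imp_cong)
qed

section \<open>Measurability, boundedness and symmetry of the integral operator\<close>

lemma measurable_unit_lborel: "(\<lambda>x. x) \<in> unit_lborel \<rightarrow>\<^sub>M lborel"
  by (rule measurable_restrict_space1[OF measurable_ident_sets[OF refl]])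

text \<open>Only the integration variable is restricted: \<open>K_op W f\<close> has to be
  measurable on the whole line to lie in \<open>L2\<close>.\<close>

lemma measurable_graphon_unit:
  assumes "graphon W"
  shows "(\<lambda>p. W (fst p) (snd p)) \<in> borel_measurable (lborel \<Otimes>\<^sub>M unit_lborel)"
proof -
  have id: "(\<lambda>p. (fst p, snd p)) \<in> lborel \<Otimes>\<^sub>M unit_lborel \<rightarrow>\<^sub>M lborel \<Otimes>\<^sub>M lborel"
    by (rule measurable_Pair[OF measurable_fst measurable_compose[OF measurable_snd measurable_unit_lborel]])
  have W: "(\<lambda>p. W (fst p) (snd p)) \<in> borel_measurable (lborel \<Otimes>\<^sub>M lborel)"
    using assms unfolding graphon_def by blast
  show ?thesis
    using measurable_compose[OF id W] unfolding fst_conv snd_conv .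
qed

lemma K_op_unit: "K_op W f x = (\<integral>y. W x y * f y \<partial>unit_lborel)"
  unfolding K_op_def by (rule set_lebesgue_integral_unit)

lemma graphon_section_L2:
  assumes "graphon W" "x \<in> {0..1}"
  shows "W x \<in> L2" "l2norm (W x) \<le> 1"
proof -
  have "(\<lambda>p. W (fst p) (snd p)) \<in> borel_measurable (lborel \<Otimes>\<^sub>M lborel)"
    using assms(1) unfolding graphon_def by blast
  from measurable_compose[OF measurable_Pair1' this, of x]
  have meas: "W x \<in> borel_measurable lborel" by simp
  have bound: "\<bar>W x y\<bar> \<le> 1" if "y \<in> {0..1}" for y
    using assms that by (auto simp: graphon_def)
  show L2: "W x \<in> L2"
    by (rule L2_bounded[OF meas bound])
  have "(\<integral>y. (W x y)\<^sup>2 \<partial>unit_lborel) \<le> (\<integral>y. 1 \<partial>unit_lborel)"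
    using L2 power_mono[OF bound, of _ 2]
    by (intro integral_mono) (auto simp: L2_iff space_restrict_space)
  also have "\<dots> = 1"
    using unit_lborel_prob by (simp add: measure_def)
  finally show "l2norm (W x) \<le> 1"
    by (simp add: l2norm_def set_lebesgue_integral_unit)
qed

text \<open>As an inner product with a section of \<open>W\<close>, the value depends on the class
  of \<open>f\<close> alone, and Cauchy-Schwarz and Bessel become available at each point.\<close>

lemma K_op_inner:
  assumes "graphon W" "x \<in> {0..1}" "f \<in> L2"
  shows "K_op W f x = cls (W x) \<bullet> cls f"
  using graphon_section_L2[OF assms(1,2)] assms(3)
  by (simp add: inner_cls l2inner_unit K_op_unit)

lemma K_op_L2:
  assumes W: "graphon W" and f: "f \<in> L2"
  shows "K_op W f \<in> L2"
proof (rule L2_bounded)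
  have [measurable]: "f \<in> borel_measurable unit_lborel"
    by (rule L2_measurable_unit[OF f])
  note [measurable] = measurable_graphon_unit[OF W]
  have "(\<lambda>(x, y). W x y * f y) \<in> borel_measurable (lborel \<Otimes>\<^sub>M unit_lborel)"
    unfolding case_prod_beta by measurable
  then show "K_op W f \<in> borel_measurable lborel"
    unfolding K_op_unit[abs_def] by (rule unit_lborel.borel_measurable_lebesgue_integral)
  fix x :: real assume x: "x \<in> {0..1}"
  have "\<bar>cls (W x) \<bullet> cls f\<bar> \<le> norm (cls (W x)) * norm (cls f)"
    by (rule Cauchy_Schwarz_ineq2)
  also have "\<dots> \<le> 1 * norm (cls f)"
    using graphon_section_L2[OF W x] by (intro mult_right_mono) (auto simp: norm_cls)
  finally show "\<bar>K_op W f x\<bar> \<le> norm (cls f)"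
    using K_op_inner[OF W x f] by simp
qed

text \<open>Fubini and the symmetry of \<open>W\<close>. Since \<open>W\<close> is at most 1 on the
  unit square, integrability of the full integrand reduces to that of
  \<open>f (snd p) * g (fst p)\<close>.\<close>

lemma K_op_symmetric:
  assumes W: "graphon W" and f: "f \<in> L2" and g: "g \<in> L2"
  shows "l2inner (K_op W f) g = l2inner f (K_op W g)"
proof -
  interpret pair_sigma_finite unit_lborel unit_lborel ..
  have [measurable]: "f \<in> borel_measurable unit_lborel" "g \<in> borel_measurable unit_lborel"
    using f g by (auto intro: L2_measurable_unit)
  have int: "integrable unit_lborel f" "integrable unit_lborel g"
    using f g by (auto intro: L2_abs_integral_le)
  have id: "(\<lambda>p. (fst p, snd p)) \<in> unit_lborel \<Otimes>\<^sub>M unit_lborel \<rightarrow>\<^sub>M lborel \<Otimes>\<^sub>M unit_lborel"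
    by (rule measurable_Pair[OF measurable_compose[OF measurable_fst measurable_unit_lborel] measurable_snd])
  have [measurable]: "(\<lambda>p. W (fst p) (snd p)) \<in> borel_measurable (unit_lborel \<Otimes>\<^sub>M unit_lborel)"
    using measurable_compose[OF id measurable_graphon_unit[OF W]] unfolding fst_conv snd_conv .
  have "integrable (unit_lborel \<Otimes>\<^sub>M unit_lborel) (\<lambda>p. f (snd p) * g (fst p))"
  proof (rule Fubini_integrable)
    have "integrable unit_lborel (\<lambda>x. \<bar>g x\<bar> * (\<integral>y. \<bar>f y\<bar> \<partial>unit_lborel))"
      using int by (intro integrable_mult_left integrable_abs)
    then show "integrable unit_lborel (\<lambda>x. \<integral>y. norm (f (snd (x, y)) * g (fst (x, y))) \<partial>unit_lborel)"
      by (simp add: abs_mult mult.commute)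
  qed (use int in auto)
  then have "integrable (unit_lborel \<Otimes>\<^sub>M unit_lborel) (\<lambda>p. W (fst p) (snd p) * (f (snd p) * g (fst p)))"
  proof (rule Bochner_Integration.integrable_bound)
    have "AE p in unit_lborel \<Otimes>\<^sub>M unit_lborel. \<bar>W (fst p) (snd p)\<bar> \<le> 1"
      using W by (intro AE_I2) (auto simp: graphon_def space_pair_measure space_restrict_space)
    then show "AE p in unit_lborel \<Otimes>\<^sub>M unit_lborel.
        norm (W (fst p) (snd p) * (f (snd p) * g (fst p))) \<le> norm (f (snd p) * g (fst p))"
      by eventually_elim (simp add: abs_mult mult_left_le_one_le)
  qed measurable
  then have "integrable (unit_lborel \<Otimes>\<^sub>M unit_lborel) (\<lambda>(x, y). W x y * f y * g x)"
    by (simp only: split_beta' mult.assoc)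
  from Fubini_integral[OF this]
  have "(\<integral>x. K_op W f x * g x \<partial>unit_lborel) = (\<integral>y. (\<integral>x. W x y * f y * g x \<partial>unit_lborel) \<partial>unit_lborel)"
    by (simp add: K_op_unit)
  also have "\<dots> = (\<integral>y. f y * K_op W g y \<partial>unit_lborel)"
  proof (rule Bochner_Integration.integral_cong[OF refl])
    fix y assume y: "y \<in> space unit_lborel"
    have "(\<integral>x. W x y * f y * g x \<partial>unit_lborel) = (\<integral>x. f y * (W y x * g x) \<partial>unit_lborel)"
      using W y
      by (intro Bochner_Integration.integral_cong[OF refl])
         (auto simp: graphon_def space_restrict_space)
    then show "(\<integral>x. W x y * f y * g x \<partial>unit_lborel) = f y * K_op W g y"
      by (simp add: K_op_unit)
  qed
  finally show ?thesis by (simp add: l2inner_unit)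
qed

text \<open>Defined through a representative instead of lifted, because compatibility with
  \<open>L2_rel\<close> depends on \<open>graphon W\<close>.\<close>

definition K_l2 :: "(real \<Rightarrow> real \<Rightarrow> real) \<Rightarrow> l2 \<Rightarrow> l2" where
  "K_l2 W x = cls (K_op W (rep_l2 x))"

lemma K_l2_cls:
  assumes W: "graphon W" and f: "f \<in> L2"
  shows "K_l2 W (cls f) = cls (K_op W f)"
proof -
  have "K_op W (rep_l2 (cls f)) x = K_op W f x" if "x \<in> {0..1}" for x
    using that f by (simp add: K_op_inner[OF W])
  then have "ae_eq (K_op W (rep_l2 (cls f))) (K_op W f)"
    by (simp add: ae_eq_def)
  then show ?thesis
    using W f by (simp add: K_l2_def cls_eq_iff K_op_L2)
qed

section \<open>Identification of the given spectral objects with \<open>proj\<close> and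
  \<open>spec\<close>\<close>

locale graphon_operator =
  fixes W :: "real \<Rightarrow> real \<Rightarrow> real"
  assumes W: "graphon W"
begin

sublocale symmetric_operator "K_l2 W"
proof
  fix x y :: l2
  obtain f g where "f \<in> L2" "x = cls f" "g \<in> L2" "y = cls g"
    using cls_rep rep_l2_L2 by metis
  then show "K_l2 W x \<bullet> y = x \<bullet> K_l2 W y"
    by (simp add: K_l2_cls[OF W] inner_cls K_op_L2[OF W] K_op_symmetric[OF W])
qed

lemma eigenspace_iff: "f \<in> eigenspace W l \<longleftrightarrow> f \<in> L2 \<and> cls f \<in> eig l"
  by (auto simp: eigenspace_def eig_def K_l2_cls[OF W] cls_eq_iff K_op_L2[OF W] L2_scale simp flip: cls_scale)

text \<open>An eigenvector breaks the injectivity clause of \<open>K_spectrum\<close>. A spectral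
  point that is not an eigenvalue has zero projection, so sums over \<open>K_spectrum W\<close> and
  over all reals agree.\<close>

lemma K_spectrum_eigenvalue:
  assumes "eig l \<noteq> {0}"
  shows "l \<in> K_spectrum W"
proof -
  obtain x where "x \<in> eig l" "x \<noteq> 0"
    using eig_nontrivial[OF assms] by blast
  then have f: "rep_l2 x \<in> eigenspace W l" "\<not> ae_eq (rep_l2 x) (\<lambda>x. 0)"
    by (simp_all add: eigenspace_iff cls_zero flip: cls_eq_iff)
  then have "ae_eq (\<lambda>y. K_op W (rep_l2 x) y - l * rep_l2 x y) (\<lambda>x. 0)"
    by (simp add: eigenspace_def ae_eq_def)
  then show ?thesis
    using f unfolding K_spectrum_def by auto
qed

lemma proj_outside_spectrum: "l \<notin> K_spectrum W \<Longrightarrow> proj l x = 0"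
  using K_spectrum_eigenvalue proj_trivial by blast

text \<open>The \<open>SOME\<close> in \<open>orth_proj\<close> selects one of many representatives,
  but uniqueness of the projection fixes its class.\<close>

lemma P_point_proj:
  assumes h: "h \<in> L2"
  shows "P_point W l h \<in> L2" "cls (P_point W l h) = proj l (cls h)"
proof -
  define Q where "Q g \<longleftrightarrow> g \<in> eigenspace W l \<and> (\<forall>k\<in>eigenspace W l. l2inner (\<lambda>x. h x - g x) k = 0)" for g
  have Q: "Q g \<longleftrightarrow> g \<in> L2 \<and> cls g \<in> eig l \<and> (\<forall>k\<in>eig l. (cls h - cls g) \<bullet> k = 0)" for g
  proof (cases "g \<in> L2")
    case True
    have "(\<forall>k\<in>eigenspace W l. l2inner (\<lambda>x. h x - g x) k = 0)
      \<longleftrightarrow> (\<forall>k\<in>eigenspace W l. (cls h - cls g) \<bullet> cls k = 0)"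
      using h True by (auto simp: eigenspace_iff L2_diff inner_cls simp flip: cls_diff)
    also have "\<dots> \<longleftrightarrow> (\<forall>k\<in>eig l. (cls h - cls g) \<bullet> k = 0)"
      unfolding eigenspace_iff Ball_def using cls_rep rep_l2_L2 by metis
    finally show ?thesis
      using True by (simp add: Q_def eigenspace_iff)
  qed (simp add: Q_def eigenspace_iff)
  have "Q (rep_l2 (proj l (cls h)))"
    by (simp add: Q proj_eig proj_orthogonal)
  then have "Q (P_point W l h)"
    unfolding P_point_def orth_proj_def Q_def[symmetric] by (rule someI[of Q])
  then show "P_point W l h \<in> L2" "cls (P_point W l h) = proj l (cls h)"
    by (auto simp: Q intro!: proj_unique[symmetric])
qed

text \<open>Summability in the complete space \<open>l2\<close> provides a witness for the
  \<open>SOME\<close>, and uniqueness of sums makes every witness a representative of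
  \<open>spec f (cls h)\<close>.\<close>

lemma spec_integral_spec:
  assumes "bounded (range f)" "h \<in> L2"
  shows "spec_integral f W h \<in> L2" "cls (spec_integral f W h) = spec f (cls h)"
proof -
  have "l2_has_sum (\<lambda>l x. f l * P_point W l h x) (K_spectrum W) g \<longleftrightarrow> cls g = spec f (cls h)"
    if "g \<in> L2" for g
  proof -
    have "l2_has_sum (\<lambda>l x. f l * P_point W l h x) (K_spectrum W) g
      \<longleftrightarrow> ((\<lambda>l. f l *\<^sub>R proj l (cls h)) has_sum cls g) (K_spectrum W)"
      using that assms
      by (simp add: l2_has_sum_iff L2_scale P_point_proj cls_scale)
    also have "\<dots> \<longleftrightarrow> ((\<lambda>l. f l *\<^sub>R proj l (cls h)) has_sum cls g) UNIV"
      by (rule has_sum_cong_neutral) (auto simp: proj_outside_spectrum)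
    also have "\<dots> \<longleftrightarrow> cls g = spec f (cls h)"
      using has_sum_spec[OF assms(1)] spec_eqI[OF assms(1)] by metis
    finally show ?thesis .
  qed
  then have "\<exists>g. g \<in> L2 \<and> l2_has_sum (\<lambda>l x. f l * P_point W l h x) (K_spectrum W) g"
    and *: "\<And>g. g \<in> L2 \<and> l2_has_sum (\<lambda>l x. f l * P_point W l h x) (K_spectrum W) g \<Longrightarrow>
      g \<in> L2 \<and> cls g = spec f (cls h)"
    using cls_rep rep_l2_L2 by metis+
  from *[OF someI_ex[OF this(1)]]
  show "spec_integral f W h \<in> L2" "cls (spec_integral f W h) = spec f (cls h)"
    unfolding spec_integral_def by auto
qed

lemma P_set_spec:
  assumes h: "h \<in> L2"
  shows "P_set W A h \<in> L2" "cls (P_set W A h) = spec (indicator A) (cls h)"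
proof -
  have bdd: "bounded (range (indicator A :: real \<Rightarrow> real))"
    by (auto simp: bounded_iff indicator_def intro!: exI[of _ 1])
  have "l2_has_sum (\<lambda>l. P_point W l h) (K_spectrum W \<inter> A) g \<longleftrightarrow> cls g = spec (indicator A) (cls h)"
    if "g \<in> L2" for g
  proof -
    have "l2_has_sum (\<lambda>l. P_point W l h) (K_spectrum W \<inter> A) g
      \<longleftrightarrow> ((\<lambda>l. proj l (cls h)) has_sum cls g) (K_spectrum W \<inter> A)"
      using that h by (simp add: l2_has_sum_iff P_point_proj)
    \<comment> \<open>Restricting the index set to \<open>A\<close> and weighting by its indicator
      differ by zero terms only.\<close>
    also have "\<dots> \<longleftrightarrow> ((\<lambda>l. indicator A l *\<^sub>R proj l (cls h)) has_sum cls g) UNIV"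
      by (rule has_sum_cong_neutral) (auto simp: proj_outside_spectrum indicator_def split: if_splits)
    also have "\<dots> \<longleftrightarrow> cls g = spec (indicator A) (cls h)"
      using has_sum_spec[OF bdd] spec_eqI[OF bdd] by metis
    finally show ?thesis .
  qed
  then have "\<exists>g. g \<in> L2 \<and> l2_has_sum (\<lambda>l. P_point W l h) (K_spectrum W \<inter> A) g"
    and *: "\<And>g. g \<in> L2 \<and> l2_has_sum (\<lambda>l. P_point W l h) (K_spectrum W \<inter> A) g \<Longrightarrow>
      g \<in> L2 \<and> cls g = spec (indicator A) (cls h)"
    using cls_rep rep_l2_L2 by metis+
  from *[OF someI_ex[OF this(1)]]
  show "P_set W A h \<in> L2" "cls (P_set W A h) = spec (indicator A) (cls h)"
    unfolding P_set_def by auto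
qed

text \<open>The squares of the eigenvalues sum to at most the squared Hilbert--Schmidt norm of the
  kernel: apply Bessel's inequality to the sections of W and integrate.\<close>

lemma finite_large_eigenvalues:
  assumes "0 < \<delta>"
  shows "finite {l. \<delta> \<le> \<bar>l\<bar> \<and> eig l \<noteq> {0}}"
proof -
  \<comment> \<open>A common bound on the size of finite subsets suffices. The constant compares
    \<open>\<delta>\<^sup>2\<close> for each eigenvalue with the squared Hilbert-Schmidt norm, which
    is at most 1.\<close>
  have "card F \<le> nat \<lfloor>1 / \<delta>\<^sup>2\<rfloor>"
    if F: "F \<subseteq> {l. \<delta> \<le> \<bar>l\<bar> \<and> eig l \<noteq> {0}}" "finite F" for F
  proof -
    have "\<exists>e. e \<in> eig l \<and> norm e = 1" if "l \<in> F" for l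
    proof -
      have "eig l \<noteq> {0}"
        using F(1) that by auto
      then obtain x where x: "x \<in> eig l" "x \<noteq> 0"
        using eig_nontrivial by blast
      then have "sgn x \<in> eig l" "norm (sgn x) = 1"
        by (simp_all add: sgn_div_norm subspace_scale[OF subspace_eig])
      then show ?thesis by blast
    qed
    then obtain e where e: "\<And>l. l \<in> F \<Longrightarrow> e l \<in> eig l" "\<And>l. l \<in> F \<Longrightarrow> norm (e l) = 1"
      by metis
    \<comment> \<open>A concrete function representing \<open>l *\<^sub>R e l\<close> for
      \<open>l\<close> in \<open>F\<close>, so that its value at \<open>x\<close> is literally the
      coefficient of the section \<open>W x\<close> along \<open>e l\<close>.\<close>
    define k where "k l = K_op W (rep_l2 (e l))" for l
    have k: "k l \<in> L2" "cls (k l) = K_l2 W (e l)" for l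
      unfolding k_def K_l2_def by (simp_all add: K_op_L2[OF W])
    have pointwise: "(\<Sum>l\<in>F. (k l x)\<^sup>2) \<le> 1" if x: "x \<in> {0..1}" for x
    proof -
      \<comment> \<open>Only the component of the section in \<open>eig l\<close> meets
        \<open>e l\<close>; this turns coefficients into projections, to which Bessel
        applies.\<close>
      have "(k l x)\<^sup>2 \<le> (norm (proj l (cls (W x))))\<^sup>2" if "l \<in> F" for l
      proof -
        have "k l x = cls (W x) \<bullet> e l"
          unfolding k_def by (simp add: K_op_inner[OF W x])
        also have "\<dots> = proj l (cls (W x)) \<bullet> e l"
          using proj_orthogonal[OF e(1)[OF that], of "cls (W x)"] by (simp add: inner_diff_left)
        finally have "\<bar>k l x\<bar> \<le> norm (proj l (cls (W x)))"
          using Cauchy_Schwarz_ineq2[of "proj l (cls (W x))" "e l"] e(2)[OF that] by simp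
        from power_mono[OF this, of 2] show ?thesis by simp
      qed
      then have "(\<Sum>l\<in>F. (k l x)\<^sup>2) \<le> (\<Sum>l\<in>F. (norm (proj l (cls (W x))))\<^sup>2)"
        by (rule sum_mono)
      also have "\<dots> \<le> (norm (cls (W x)))\<^sup>2"
        by (rule Bessel[OF F(2)])
      also have "\<dots> \<le> 1"
        using graphon_section_L2[OF W x] by (simp add: norm_cls power_le_one l2norm_nonneg)
      finally show ?thesis .
    qed
    have "real (card F) * \<delta>\<^sup>2 \<le> (\<Sum>l\<in>F. l\<^sup>2)"
    proof (rule sum_bounded_below)
      fix l assume "l \<in> F"
      then have "\<delta> \<le> \<bar>l\<bar>"
        using F(1) by auto
      then show "\<delta>\<^sup>2 \<le> l\<^sup>2"
        using power_mono[of \<delta> "\<bar>l\<bar>" 2] \<open>0 < \<delta>\<close> by simp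
    qed
    also have "\<dots> = (\<Sum>l\<in>F. \<integral>x. (k l x)\<^sup>2 \<partial>unit_lborel)"
    proof (rule sum.cong[OF refl])
      fix l assume l: "l \<in> F"
      have "norm (cls (k l)) = \<bar>l\<bar>"
        using e[OF l] by (simp add: k eig_def)
      then have "(l2norm (k l))\<^sup>2 = l\<^sup>2"
        by (simp only: norm_cls[OF k(1)] power2_abs)
      then show "l\<^sup>2 = (\<integral>x. (k l x)\<^sup>2 \<partial>unit_lborel)"
        by (simp add: l2norm_def set_lebesgue_integral_unit)
    qed
    also have "\<dots> = (\<integral>x. (\<Sum>l\<in>F. (k l x)\<^sup>2) \<partial>unit_lborel)"
      using k(1) by (subst Bochner_Integration.integral_sum) (auto simp: L2_iff)
    also have "\<dots> \<le> (\<integral>x. 1 \<partial>unit_lborel)"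
      using k(1) pointwise by (intro integral_mono) (auto simp: L2_iff space_restrict_space)
    also have "\<dots> = 1"
      using unit_lborel_prob by (simp add: measure_def)
    finally have "real (card F) \<le> 1 / \<delta>\<^sup>2"
      using \<open>0 < \<delta>\<close> by (simp add: field_simps)
    then show "card F \<le> nat \<lfloor>1 / \<delta>\<^sup>2\<rfloor>"
      by (simp add: le_nat_floor)
  qed
  then show ?thesis
    using finite_if_finite_subsets_card_bdd by blast
qed

end

section \<open>Return to operator norms of maps on representatives\<close>

definition represents :: "((real \<Rightarrow> real) \<Rightarrow> real \<Rightarrow> real) \<Rightarrow> (l2 \<Rightarrow> l2) \<Rightarrow> bool" where
  "represents A B \<longleftrightarrow> (\<forall>h\<in>L2. A h \<in> L2 \<and> cls (A h) = B (cls h))"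

lemma opnorm_represents:
  assumes "represents A B"
  shows "opnorm A = (SUP x\<in>cball 0 1. norm (B x))"
proof -
  have "(\<lambda>f. l2norm (A f)) ` {f \<in> L2. l2norm f \<le> 1} = (\<lambda>x. norm (B x)) ` cball 0 1"
  proof (intro set_eqI iffI)
    fix r assume "r \<in> (\<lambda>f. l2norm (A f)) ` {f \<in> L2. l2norm f \<le> 1}"
    then obtain f where "f \<in> L2" "l2norm f \<le> 1" "r = l2norm (A f)" by auto
    then have "cls f \<in> cball 0 1" "r = norm (B (cls f))"
      using assms by (simp_all add: represents_def norm_cls flip: norm_cls[of "A f"])
    then show "r \<in> (\<lambda>x. norm (B x)) ` cball 0 1" by blast
  next
    fix r assume "r \<in> (\<lambda>x. norm (B x)) ` cball 0 1"
    then obtain x where x: "norm x \<le> 1" "r = norm (B x)" by auto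
    then have "l2norm (rep_l2 x) \<le> 1"
      using norm_cls[OF rep_l2_L2, of x] by simp
    moreover have "A (rep_l2 x) \<in> L2" "cls (A (rep_l2 x)) = B x"
      using assms rep_l2_L2[of x] cls_rep[of x] unfolding represents_def by metis+
    then have "r = l2norm (A (rep_l2 x))"
      using x(2) norm_cls by metis
    ultimately show "r \<in> (\<lambda>f. l2norm (A f)) ` {f \<in> L2. l2norm f \<le> 1}"
      by auto
  qed
  then show ?thesis by (simp add: opnorm_def)
qed

text \<open>\<open>bound\<close> makes each supremum in \<open>opnorm\<close> that of a bounded set,
  without which a real \<open>SUP\<close> carries no information. Halving \<open>e\<close> recovers
  the strict inequality from the non-strict one.\<close>

lemma net_opnorm_tendsto_iff:
  assumes T: "\<And>i. represents (T i) (B i)" and S: "represents S B0"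
    and bound: "\<And>i x. norm x \<le> 1 \<Longrightarrow> norm (B i x - B0 x) \<le> C"
  shows "net_opnorm_tendsto le T S \<longleftrightarrow>
    (\<forall>e>0. net_eventually le (\<lambda>i. \<forall>x. norm x \<le> 1 \<longrightarrow> norm (B i x - B0 x) \<le> e))"
proof -
  have "represents (\<lambda>h x. T i h x - S h x) (\<lambda>x. B i x - B0 x)" for i
    using T[of i] S by (simp add: represents_def L2_diff cls_diff)
  then have opnorm: "opnorm (\<lambda>h x. T i h x - S h x) = (SUP x\<in>cball 0 1. norm (B i x - B0 x))" for i
    by (rule opnorm_represents)
  have bdd: "bdd_above ((\<lambda>x. norm (B i x - B0 x)) ` cball 0 1)" for i
    using bound by (intro bdd_aboveI[of _ C]) auto
  have iff: "opnorm (\<lambda>h x. T i h x - S h x) \<le> e \<longleftrightarrow> (\<forall>x. norm x \<le> 1 \<longrightarrow> norm (B i x - B0 x) \<le> e)" for i e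
    unfolding opnorm by (subst cSUP_le_iff[OF _ bdd]) auto
  show ?thesis
    unfolding net_opnorm_tendsto_def net_eventually_def iff[symmetric]
  proof (intro iffI allI impI)
    fix e :: real assume "0 < e"
      and *: "\<forall>e>0. \<exists>i0. \<forall>i. le i0 i \<longrightarrow> opnorm (\<lambda>h x. T i h x - S h x) < e"
    then show "\<exists>i0. \<forall>i. le i0 i \<longrightarrow> opnorm (\<lambda>h x. T i h x - S h x) \<le> e"
      using less_imp_le by meson
  next
    fix e :: real assume "0 < e"
      and *: "\<forall>e>0. \<exists>i0. \<forall>i. le i0 i \<longrightarrow> opnorm (\<lambda>h x. T i h x - S h x) \<le> e"
    obtain i0 where "\<And>i. le i0 i \<Longrightarrow> opnorm (\<lambda>h x. T i h x - S h x) \<le> e / 2"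
      using *[rule_format, of "e / 2"] \<open>0 < e\<close> by auto
    then show "\<exists>i0. \<forall>i. le i0 i \<longrightarrow> opnorm (\<lambda>h x. T i h x - S h x) < e"
      using \<open>0 < e\<close> by (intro exI[of _ i0] allI impI) (rule order_le_less_trans[of _ "e / 2"], auto)
  qed
qed

theorem theorem2p2:
  fixes le :: "'i \<Rightarrow> 'i \<Rightarrow> bool"
    and Ws :: "'i \<Rightarrow> real \<Rightarrow> real \<Rightarrow> real"
    and W0 :: "real \<Rightarrow> real \<Rightarrow> real"
  assumes "directed le"
    and "\<And>i. graphon (Ws i)"
    and "graphon W0"
  shows "vague_conv le Ws W0 \<longleftrightarrow>
    (\<forall>f\<in>Cc. net_opnorm_tendsto le (\<lambda>i. spec_integral f (Ws i)) (spec_integral f W0))"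
proof -
  interpret G0: graphon_operator W0
    by standard fact
  interpret G: graphon_operator "Ws i" for i
    by standard fact
  interpret N: symmetric_operator_net "K_l2 W0" le "\<lambda>i. K_l2 (Ws i)"
    by unfold_locales (use assms(1) G.symmetric in auto)
  have tendsto: "net_opnorm_tendsto le A A0 \<longleftrightarrow> N.spec_tendsto f"
    if "bounded (range f)" and A: "\<And>i. represents (A i) (G.spec i f)" "represents A0 (G0.spec f)"
    for A A0 f
  proof -
    obtain C where C: "\<And>l. \<bar>f l\<bar> \<le> C"
      using \<open>bounded (range f)\<close> by (auto simp: bounded_iff)
    \<comment> \<open>The triangle inequality gives one constant for all indices, as
      \<open>net_opnorm_tendsto_iff\<close> requires.\<close>
    have "norm (G.spec i f x - G0.spec f x) \<le> C + C" if "norm x \<le> 1" for i x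
    proof -
      have "C * norm x \<le> C"
        using that C[of 0] by (intro mult_left_le) auto
      then show ?thesis
        using norm_triangle_ineq4[of "G.spec i f x" "G0.spec f x"]
          G.norm_spec_le[of f, OF C, of i x] G0.norm_spec_le[of f, OF C, of x] by linarith
    qed
    then show ?thesis
      unfolding N.spec_tendsto_def by (rule net_opnorm_tendsto_iff[OF A])
  qed
  have "net_opnorm_tendsto le (\<lambda>i. P_set (Ws i) A) (P_set W0 A) \<longleftrightarrow> N.spec_tendsto (indicator A)" for A
    by (rule tendsto) (simp_all add: represents_def G.P_set_spec G0.P_set_spec)
  moreover have "net_opnorm_tendsto le (\<lambda>i. spec_integral f (Ws i)) (spec_integral f W0)
      \<longleftrightarrow> N.spec_tendsto f" if "f \<in> Cc" for f
    using Cc_bounded[OF that]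
    by (intro tendsto) (simp_all add: represents_def G.spec_integral_spec G0.spec_integral_spec)
  ultimately show ?thesis
    using N.spec_tendsto_intervals_iff_Cc[OF G0.finite_large_eigenvalues]
    by (simp add: vague_conv_def)
qed

end
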